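(* There is a randomized algorithm that, given integer parameters $k \geq 0$ and $\Delta \geq 1$, a probability parameter $p < 1$, a starting vertex $s$, and query access (in the incidence-lists model) to a directed graph $G=(V,E)$, performs $O\big((k^2+1)(\Delta+k)\log(\tfrac{1}{1-p})\big)$ queries and returns a set of vertices $U$ such that (1) if there is a $k$-edge-out component containing $s$ of edge size at most $\Delta$ in $G$, then $U \supseteq \{s\}$ with probability at least $p$, and (2) if $U \supseteq \{s\}$, then $U$ is a minimal $k$-edge-out component of edge size at most $O((k+1)(\Delta+k))$ in $G$. If every query to the graph can be performed in expected constant time, then the running time of the algorithm is $O\big((k^2+1)(\Delta+k)\log(\tfrac{1}{1-p})\big)$.
   Context: Incidence-lists query model: for a directed graph, in one query the algorithm may ask, for any vertex $v$ and integer $i\ge 1$, for the $i$-th outgoing edge of $v$ or the $i$-th incoming edge of $v$ (receiving $\bot$ if there are fewer than $i$ such edges). For $A,B\subseteq V$ let $E(A,B)=E\cap(A\times B)$. A $k$-edge-out component of $G$ is a non-empty $C\subseteq V$ with $|E(C,V\setminus C)|\le k$; it is minimal if every proper subset $\hat C\subsetneq C$ has strictly more edges leaving $\hat C$ than there are edges leaving $C$. The edge size of $C$ is $|E(C,C)|$.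
   Formalization: Minimality of U is only over proper subsets containing s (the empty set, and {v} for the edge s→v with k=0, refute the stated form); log(1/(1-p)) is replaced by max(1, ln(1/(1-p))), as small p would otherwise allow no query. *)

theory Defs
  imports "HOL-Probability.SPMF" "Graph_Theory.Pair_Digraph"
begin

section \<open>Edge-out components\<close>

definition edges_between :: "'a pair_pre_digraph \<Rightarrow> 'a set \<Rightarrow> 'a set \<Rightarrow> ('a \<times> 'a) set" where
  "edges_between G A B = parcs G \<inter> (A \<times> B)"

definition edges_leaving :: "'a pair_pre_digraph \<Rightarrow> 'a set \<Rightarrow> ('a \<times> 'a) set" where
  "edges_leaving G C = edges_between G C (pverts G - C)"

definition edge_size :: "'a pair_pre_digraph \<Rightarrow> 'a set \<Rightarrow> nat" where
  "edge_size G C = card (edges_between G C C)"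

definition edge_out_component :: "'a pair_pre_digraph \<Rightarrow> nat \<Rightarrow> 'a set \<Rightarrow> bool" where
  "edge_out_component G k C \<longleftrightarrow> C \<noteq> {} \<and> C \<subseteq> pverts G \<and> card (edges_leaving G C) \<le> k"

text \<open>
  Minimality is relative to a vertex \<open>s\<close>: the proper subsets it ranges over are those that
  contain \<open>s\<close>.  If all non-empty proper subsets were admitted, a local algorithm for
  components containing \<open>s\<close> could not exist; see \<open>unanchored_minimality_fails\<close> below.
\<close>

definition minimal_edge_out_component ::
    "'a pair_pre_digraph \<Rightarrow> nat \<Rightarrow> 'a \<Rightarrow> 'a set \<Rightarrow> bool" where
  "minimal_edge_out_component G k s C \<longleftrightarrow>
     edge_out_component G k C \<and> s \<in> C \<and>
     (\<forall>C'. s \<in> C' \<and> C' \<subset> C \<longrightarrow> card (edges_leaving G C') > card (edges_leaving G C))"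

lemma unanchored_minimality_fails:
  fixes G :: "nat pair_pre_digraph"
  defines "G \<equiv> \<lparr>pverts = {0, 1}, parcs = {(0, 1)}\<rparr>"
  shows "pair_fin_digraph G"
    and "edge_out_component G 0 {0, 1}" and "edge_size G {0, 1} = 1"
    and "\<not> (\<exists>C. edge_out_component G 0 C \<and> 0 \<in> C \<and>
            (\<forall>C'. C' \<noteq> {} \<and> C' \<subset> C \<longrightarrow> card (edges_leaving G C') > card (edges_leaving G C)))"
proof -
  show "pair_fin_digraph G"
    by unfold_locales (auto simp: G_def)
  show "edge_out_component G 0 {0, 1}"
    by (auto simp: edge_out_component_def edges_leaving_def edges_between_def G_def)
  have "edges_between G {0, 1} {0, 1} = {(0, 1)}"
    by (auto simp: edges_between_def G_def)
  then show "edge_size G {0, 1} = 1"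
    by (simp add: edge_size_def)
  show "\<not> (\<exists>C. edge_out_component G 0 C \<and> 0 \<in> C \<and>
            (\<forall>C'. C' \<noteq> {} \<and> C' \<subset> C \<longrightarrow> card (edges_leaving G C') > card (edges_leaving G C)))"
  proof
    assume "\<exists>C. edge_out_component G 0 C \<and> 0 \<in> C \<and>
            (\<forall>C'. C' \<noteq> {} \<and> C' \<subset> C \<longrightarrow> card (edges_leaving G C') > card (edges_leaving G C))"
    then obtain C where C: "edge_out_component G 0 C" "0 \<in> C"
      and min: "\<forall>C'. C' \<noteq> {} \<and> C' \<subset> C \<longrightarrow>
        card (edges_leaving G C') > card (edges_leaving G C)"
      by (elim exE conjE)
    have "edges_leaving G C \<subseteq> {(0, 1)}"
      by (auto simp: edges_leaving_def edges_between_def G_def)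
    then have "finite (edges_leaving G C)"
      by (rule finite_subset) simp
    moreover have "card (edges_leaving G C) = 0"
      using C(1) by (simp add: edge_out_component_def)
    ultimately have none: "edges_leaving G C = {}"
      by simp
    have "1 \<in> C"
    proof (rule ccontr)
      assume "1 \<notin> C"
      with C(2) have "(0, 1) \<in> edges_leaving G C"
        by (simp add: edges_leaving_def edges_between_def G_def)
      with none show False by simp
    qed
    with C(2) have "{1} \<subset> C" by auto
    moreover have "edges_leaving G {1} = {}"
      by (simp add: edges_leaving_def edges_between_def G_def)
    ultimately have "card (edges_leaving G C) < card ({} :: (nat \<times> nat) set)"
      using min[rule_format, of "{1}"] by (simp only: insert_not_empty not_False_eq_True simp_thms)
    then show False by simp
  qed
qed


section \<open>Incidence-lists queries\<close>

text \<open>The incidence lists present the edges in an arbitrary order.\<close>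

definition incidence_lists ::
    "'a pair_pre_digraph \<Rightarrow> ('a \<Rightarrow> ('a \<times> 'a) list) \<Rightarrow> ('a \<Rightarrow> ('a \<times> 'a) list) \<Rightarrow> bool" where
  "incidence_lists G outs ins \<longleftrightarrow>
     (\<forall>v. distinct (outs v) \<and> set (outs v) = {e \<in> parcs G. fst e = v} \<and>
          distinct (ins v) \<and> set (ins v) = {e \<in> parcs G. snd e = v})"

text \<open>\<open>OutEdge v i\<close> and \<open>InEdge v i\<close> ask for the \<open>i\<close>-th edge, counting from 1.\<close>

datatype query = OutEdge nat nat | InEdge nat nat

definition nth_entry :: "'b list \<Rightarrow> nat \<Rightarrow> 'b option" where
  "nth_entry xs i = (if 1 \<le> i \<and> i \<le> length xs then Some (xs ! (i - 1)) else None)"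

text \<open>
  The queried vertex is known to the asking program, so an edge is reported as its other
  endpoint \<open>w\<close>; as a machine word this is \<open>w + 1\<close>, with 0 for the answer "no such edge".
\<close>

fun answer :: "(nat \<Rightarrow> (nat \<times> nat) list) \<Rightarrow> (nat \<Rightarrow> (nat \<times> nat) list) \<Rightarrow> query \<Rightarrow> nat" where
  "answer outs ins (OutEdge v i) =
     (case nth_entry (outs v) i of None \<Rightarrow> 0 | Some e \<Rightarrow> Suc (snd e))"
| "answer outs ins (InEdge v i) =
     (case nth_entry (ins v) i of None \<Rightarrow> 0 | Some e \<Rightarrow> Suc (fst e))"


section \<open>Randomized algorithms with query access\<close>

text \<open>
  Algorithms are programs for a randomized random access machine: finitely many word variables,
  finitely many zero-initialised arrays of words indexed by words, and finitely many real
  variables (needed only because the success probability is a real input).  Neither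
  multiplication nor bit operations on words are available, and real variables admit only
  addition, subtraction and comparison, so no large computation can be hidden in a unit-cost
  instruction.
\<close>

datatype aexp = Const nat | Var nat | Elem nat aexp | Plus aexp aexp | Minus aexp aexp

datatype rexp = ROne | RVar nat | RPlus rexp rexp | RMinus rexp rexp

datatype bexp = Le aexp aexp | RLe rexp rexp | Neg bexp | Conj bexp bexp

datatype com =
    Skip
  | Assign nat aexp
  | Store nat aexp aexp
  | RAssign nat rexp
  | Random nat aexp
  | QueryOut nat aexp aexp
  | QueryIn nat aexp aexp
  | Seq com com
  | IfElse bexp com com
  | While bexp com

text \<open>The last two fields are accounting only; programs cannot read them.\<close>

record state =
  vars :: "nat \<Rightarrow> nat"
  arrays :: "nat \<Rightarrow> nat \<Rightarrow> nat"
  rvars :: "nat \<Rightarrow> real"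
  num_queries :: nat
  run_time :: nat

primrec aval :: "aexp \<Rightarrow> state \<Rightarrow> nat" where
  "aval (Const n) \<sigma> = n"
| "aval (Var x) \<sigma> = vars \<sigma> x"
| "aval (Elem a i) \<sigma> = arrays \<sigma> a (aval i \<sigma>)"
| "aval (Plus a b) \<sigma> = aval a \<sigma> + aval b \<sigma>"
| "aval (Minus a b) \<sigma> = aval a \<sigma> - aval b \<sigma>"

primrec rval :: "rexp \<Rightarrow> state \<Rightarrow> real" where
  "rval ROne \<sigma> = 1"
| "rval (RVar x) \<sigma> = rvars \<sigma> x"
| "rval (RPlus a b) \<sigma> = rval a \<sigma> + rval b \<sigma>"
| "rval (RMinus a b) \<sigma> = rval a \<sigma> - rval b \<sigma>"

primrec bval :: "bexp \<Rightarrow> state \<Rightarrow> bool" where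
  "bval (Le a b) \<sigma> \<longleftrightarrow> aval a \<sigma> \<le> aval b \<sigma>"
| "bval (RLe a b) \<sigma> \<longleftrightarrow> rval a \<sigma> \<le> rval b \<sigma>"
| "bval (Neg b) \<sigma> \<longleftrightarrow> \<not> bval b \<sigma>"
| "bval (Conj b c) \<sigma> \<longleftrightarrow> bval b \<sigma> \<and> bval c \<sigma>"

definition set_var :: "nat \<Rightarrow> nat \<Rightarrow> state \<Rightarrow> state" where
  "set_var x n \<sigma> = \<sigma>\<lparr>vars := (vars \<sigma>)(x := n)\<rparr>"

definition set_elem :: "nat \<Rightarrow> nat \<Rightarrow> nat \<Rightarrow> state \<Rightarrow> state" where
  "set_elem a i n \<sigma> = \<sigma>\<lparr>arrays := (arrays \<sigma>)(a := (arrays \<sigma> a)(i := n))\<rparr>"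

definition set_rvar :: "nat \<Rightarrow> real \<Rightarrow> state \<Rightarrow> state" where
  "set_rvar x r \<sigma> = \<sigma>\<lparr>rvars := (rvars \<sigma>)(x := r)\<rparr>"

definition elapse :: "nat \<Rightarrow> state \<Rightarrow> state" where
  "elapse t \<sigma> = \<sigma>\<lparr>run_time := run_time \<sigma> + t\<rparr>"

text \<open>Non-termination shows up as missing probability mass.\<close>

partial_function (spmf) while_spmf :: "('s \<Rightarrow> bool) \<Rightarrow> ('s \<Rightarrow> 's spmf) \<Rightarrow> 's \<Rightarrow> 's spmf" where
  "while_spmf b f \<sigma> = (if b \<sigma> then bind_spmf (f \<sigma>) (while_spmf b f) else return_spmf \<sigma>)"

text \<open>
  \<open>ans\<close> answers the queries and \<open>qt q\<close> is the distribution of the time that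
  query \<open>q\<close> takes, sampled afresh for every query.
\<close>

definition perform_query ::
    "(query \<Rightarrow> nat) \<Rightarrow> (query \<Rightarrow> nat pmf) \<Rightarrow> nat \<Rightarrow> query \<Rightarrow> state \<Rightarrow> state spmf" where
  "perform_query ans qt x q \<sigma> =
     map_spmf (\<lambda>t. elapse (1 + t) (set_var x (ans q) (\<sigma>\<lparr>num_queries := num_queries \<sigma> + 1\<rparr>)))
       (spmf_of_pmf (qt q))"

text \<open>
  Each executed instruction and each evaluated branching condition takes one time unit.
  Expressions occur only literally in the program, so their sizes are bounded by a constant
  that depends on the program alone.  \<open>Random x a\<close> draws a uniform number from \<open>{0..a}\<close>.
\<close>

primrec exec :: "(query \<Rightarrow> nat) \<Rightarrow> (query \<Rightarrow> nat pmf) \<Rightarrow> com \<Rightarrow> state \<Rightarrow> state spmf" where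
  "exec ans qt Skip \<sigma> = return_spmf (elapse 1 \<sigma>)"
| "exec ans qt (Assign x a) \<sigma> = return_spmf (elapse 1 (set_var x (aval a \<sigma>) \<sigma>))"
| "exec ans qt (Store a i e) \<sigma> = return_spmf (elapse 1 (set_elem a (aval i \<sigma>) (aval e \<sigma>) \<sigma>))"
| "exec ans qt (RAssign x r) \<sigma> = return_spmf (elapse 1 (set_rvar x (rval r \<sigma>) \<sigma>))"
| "exec ans qt (Random x a) \<sigma> =
     map_spmf (\<lambda>n. elapse 1 (set_var x n \<sigma>)) (spmf_of_set {0..aval a \<sigma>})"
| "exec ans qt (QueryOut x v i) \<sigma> = perform_query ans qt x (OutEdge (aval v \<sigma>) (aval i \<sigma>)) \<sigma>"
| "exec ans qt (QueryIn x v i) \<sigma> = perform_query ans qt x (InEdge (aval v \<sigma>) (aval i \<sigma>)) \<sigma>"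
| "exec ans qt (Seq c d) \<sigma> = bind_spmf (exec ans qt c \<sigma>) (exec ans qt d)"
| "exec ans qt (IfElse b c d) \<sigma> =
     (if bval b \<sigma> then exec ans qt c (elapse 1 \<sigma>) else exec ans qt d (elapse 1 \<sigma>))"
| "exec ans qt (While b c) \<sigma> =
     map_spmf (elapse 1) (while_spmf (bval b) (\<lambda>\<sigma>. exec ans qt c (elapse 1 \<sigma>)) \<sigma>)"

definition initial_state :: "nat \<Rightarrow> nat \<Rightarrow> real \<Rightarrow> nat \<Rightarrow> state" where
  "initial_state k \<Delta> p s =
     \<lparr>vars = (\<lambda>_. 0)(0 := k, 1 := \<Delta>, 2 := s), arrays = (\<lambda>_ _. 0), rvars = (\<lambda>_. 0)(0 := p),
      num_queries = 0, run_time = 0\<rparr>"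

text \<open>
  The returned set is listed in the first entries of array 0, and variable 0 holds the length
  of this list.
\<close>

definition returned_set :: "state \<Rightarrow> nat set" where
  "returned_set \<sigma> = {arrays \<sigma> 0 i | i. i < vars \<sigma> 0}"

definition run :: "com \<Rightarrow> (nat \<Rightarrow> (nat \<times> nat) list) \<Rightarrow> (nat \<Rightarrow> (nat \<times> nat) list) \<Rightarrow>
    (query \<Rightarrow> nat pmf) \<Rightarrow> nat \<Rightarrow> nat \<Rightarrow> real \<Rightarrow> nat \<Rightarrow> state spmf" where
  "run alg outs ins qt k \<Delta> p s = exec (answer outs ins) qt alg (initial_state k \<Delta> p s)"

text \<open>
  The maximum with 1 is needed because a bound on the number of queries that is less than 1
  forbids all queries: the factor \<open>ln (1 / (1 - p))\<close> is at most 0 for \<open>p \<le> 0\<close> and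
  tends to 0 as \<open>p\<close> tends to 0.  For \<open>p\<close> bounded away from 0 the maximum changes the
  bound by a constant factor only.
\<close>

definition query_bound :: "nat \<Rightarrow> nat \<Rightarrow> real \<Rightarrow> real" where
  "query_bound k \<Delta> p = (real k ^ 2 + 1) * (real \<Delta> + real k) * max 1 (ln (1 / (1 - p)))"

end

theory Submission
  imports Defs
begin

text \<open>
  A round explores the residual graph from \<open>s\<close> by breadth-first search and stops after
  \<open>N = 2 (k + 1) (\<Delta> + k)\<close> scanned edges.  If the search gets stuck earlier, the visited set is
  returned.  Otherwise a uniformly random scanned edge \<open>(u, w)\<close> is drawn and the tree path from
  \<open>s\<close> to \<open>u\<close> is reversed.  Each vertex \<open>v\<close> of the path overwrites its path edge by an edge to its
  predecessor, where the edge \<open>(u, w)\<close> serves as the path edge of \<open>u\<close>, and \<open>s\<close> overwrites its path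
  edge by a loop; so no vertex ever changes its out-degree.  For \<open>X\<close> containing \<open>s\<close>, a reversal
  decreases the number of edges leaving \<open>X\<close> by one if \<open>u \<notin> X\<close> or \<open>w \<notin> X\<close>, and by zero otherwise.
  As this decrease is antitone in \<open>X\<close>, the set of all vertices reachable from \<open>s\<close> in the residual
  graph is a minimal component.

  Let \<open>C\<close> be a component as sought.  At most \<open>\<Delta> + k\<close> edges start in \<open>C\<close>, so a random edge starts
  there with probability at most \<open>\<delta> = (\<Delta> + k) / N\<close>.  As long as this does not happen, every
  reversal destroys an edge leaving \<open>C\<close>; after at most \<open>k\<close> of them the search is confined to \<open>C\<close>
  and gets stuck.  Hence \<open>k + 1\<close> rounds fail with probability at most \<open>k \<delta> \<le> 1 / 2\<close>.  Independent
  attempts are repeated while \<open>x < 1\<close>, where \<open>x\<close> starts at \<open>1 - p\<close> and is doubled each time.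
\<close>

section \<open>A program logic for expected time and failure probability\<close>

text \<open>Programs cannot read \<open>run_time\<close>, so states that agree after
  \<open>erase\<close> evaluate every expression alike. \<open>num_queries\<close> is kept, because
  its final value has to be carried over to real executions.\<close>

definition erase :: "state \<Rightarrow> state" where
  "erase \<sigma> = \<sigma>\<lparr>run_time := 0\<rparr>"

lemma erase_sel [simp]:
  "vars (erase \<sigma>) = vars \<sigma>" "arrays (erase \<sigma>) = arrays \<sigma>" "rvars (erase \<sigma>) = rvars \<sigma>"
  "num_queries (erase \<sigma>) = num_queries \<sigma>"
  by (simp_all add: erase_def)

lemma erase_eq_iff:
  "erase \<sigma> = erase \<tau> \<longleftrightarrow> vars \<sigma> = vars \<tau> \<and> arrays \<sigma> = arrays \<tau> \<and> rvars \<sigma> = rvars \<tau> \<and>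
     num_queries \<sigma> = num_queries \<tau>"
  by (cases \<sigma>; cases \<tau>) (auto simp: erase_def)

lemma state_update_sel [simp]:
  "vars (elapse t \<sigma>) = vars \<sigma>" "arrays (elapse t \<sigma>) = arrays \<sigma>" "rvars (elapse t \<sigma>) = rvars \<sigma>"
  "num_queries (elapse t \<sigma>) = num_queries \<sigma>" "run_time (elapse t \<sigma>) = run_time \<sigma> + t"
  "vars (set_var x n \<sigma>) = (vars \<sigma>)(x := n)" "arrays (set_var x n \<sigma>) = arrays \<sigma>"
  "rvars (set_var x n \<sigma>) = rvars \<sigma>" "num_queries (set_var x n \<sigma>) = num_queries \<sigma>"
  "run_time (set_var x n \<sigma>) = run_time \<sigma>"
  "vars (set_elem a i n \<sigma>) = vars \<sigma>"
  "arrays (set_elem a i n \<sigma>) = (arrays \<sigma>)(a := (arrays \<sigma> a)(i := n))"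
  "rvars (set_elem a i n \<sigma>) = rvars \<sigma>" "num_queries (set_elem a i n \<sigma>) = num_queries \<sigma>"
  "run_time (set_elem a i n \<sigma>) = run_time \<sigma>"
  "vars (set_rvar y r \<sigma>) = vars \<sigma>" "arrays (set_rvar y r \<sigma>) = arrays \<sigma>"
  "rvars (set_rvar y r \<sigma>) = (rvars \<sigma>)(y := r)" "num_queries (set_rvar y r \<sigma>) = num_queries \<sigma>"
  "run_time (set_rvar y r \<sigma>) = run_time \<sigma>"
  by (simp_all add: elapse_def set_var_def set_elem_def set_rvar_def)

lemma eval_erase_eq:
  assumes "erase \<sigma> = erase \<tau>"
  shows "aval a \<sigma> = aval a \<tau>" "rval r \<sigma> = rval r \<tau>" "bval b \<sigma> = bval b \<tau>"
proof -
  show a: "aval a \<sigma> = aval a \<tau>" for a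
    using assms by (induction a) (auto simp: erase_eq_iff)
  show r: "rval r \<sigma> = rval r \<tau>" for r
    using assms by (induction r) (auto simp: erase_eq_iff)
  show "bval b \<sigma> = bval b \<tau>"
    by (induction b) (auto simp: a r)
qed

text \<open>The added 1 is the unit cost of the query instruction. Hence \<open>K\<close> is at
  least 1 and also pays for any instruction that is not a query.\<close>

definition query_time_le :: "(query \<Rightarrow> nat pmf) \<Rightarrow> ennreal \<Rightarrow> bool" where
  "query_time_le qt K \<longleftrightarrow> (\<forall>q. 1 + (\<integral>\<^sup>+ t. of_nat t \<partial>measure_pmf (qt q)) \<le> K)"

lemma query_time_le_ge_1: "query_time_le qt K \<Longrightarrow> 1 \<le> K"
  unfolding query_time_le_def by (metis dual_order.trans le_iff_add)

text \<open>
  In the second component of the coupling and in \<open>M\<close> every query takes no extra time, so the field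
  \<open>run_time\<close> counts executed steps there.
\<close>

definition coupled :: "(query \<Rightarrow> nat pmf) \<Rightarrow> state \<Rightarrow> state spmf \<Rightarrow> state \<Rightarrow> state pmf \<Rightarrow> bool" where
  "coupled qt \<sigma> D e M \<longleftrightarrow> (\<exists>J.
     D = spmf_of_pmf (map_pmf fst J) \<and> M = map_pmf snd J \<and>
     (\<forall>x \<in> set_pmf J. erase (fst x) = erase (snd x)) \<and>
     (\<forall>K. query_time_le qt K \<longrightarrow>
        (\<integral>\<^sup>+ x. of_nat (run_time (fst x)) \<partial>measure_pmf J) \<le>
        of_nat (run_time \<sigma>) + K * (\<integral>\<^sup>+ x. of_nat (run_time (snd x) - run_time e) \<partial>measure_pmf J)))"

text \<open>\<open>M\<close> does not depend on \<open>qt\<close>, so one idealised distribution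
  serves all query times. The first conjunct compares increments without truncated subtraction:
  there are at most as many queries as steps. A bound on the steps thus controls queries and
  expected time together.\<close>

definition sim :: "(query \<Rightarrow> nat) \<Rightarrow> com \<Rightarrow> state \<Rightarrow> state pmf \<Rightarrow> bool" where
  "sim ans c e M \<longleftrightarrow>
     (\<forall>e' \<in> set_pmf M. run_time e \<le> run_time e' \<and>
        num_queries e' + run_time e \<le> num_queries e + run_time e') \<and>
     (\<forall>qt \<sigma>. erase \<sigma> = erase e \<longrightarrow> coupled qt \<sigma> (exec ans qt c \<sigma>) e M)"

text \<open>Two point masses are coupled, and the time inequality comes down to
  \<open>1 \<le> K\<close>. This covers all instructions with a deterministic effect and unit cost,
  and also a loop whose test fails at once.\<close>

lemma sim_Dirac:
  assumes "\<And>qt \<sigma>. erase \<sigma> = erase e \<Longrightarrow> exec ans qt c \<sigma> = return_spmf (elapse 1 (f \<sigma>)) \<and>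
      erase (f \<sigma>) = erase (f e)"
    and "\<And>\<sigma>. run_time (f \<sigma>) = run_time \<sigma>" "num_queries (f e) = num_queries e"
  shows "sim ans c e (return_pmf (elapse 1 (f e)))"
  unfolding sim_def coupled_def
proof (intro conjI allI impI ballI)
  fix qt \<sigma> assume *: "erase \<sigma> = erase e"
  show "\<exists>J. exec ans qt c \<sigma> = spmf_of_pmf (map_pmf fst J) \<and>
     return_pmf (elapse 1 (f e)) = map_pmf snd J \<and>
     (\<forall>x \<in> set_pmf J. erase (fst x) = erase (snd x)) \<and>
     (\<forall>K. query_time_le qt K \<longrightarrow>
        (\<integral>\<^sup>+ x. of_nat (run_time (fst x)) \<partial>measure_pmf J) \<le>
        of_nat (run_time \<sigma>) + K * (\<integral>\<^sup>+ x. of_nat (run_time (snd x) - run_time e) \<partial>measure_pmf J))"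
    using assms(1)[OF *]
    by (intro exI[of _ "return_pmf (elapse 1 (f \<sigma>), elapse 1 (f e))"])
       (auto simp: assms(2) erase_eq_iff dest: query_time_le_ge_1 intro!: add_left_mono)
qed (auto simp: assms)

lemma sim_Skip: "sim ans Skip e (return_pmf (elapse 1 e))"
  using sim_Dirac[of e ans Skip id] by simp

lemma sim_Assign: "sim ans (Assign x a) e (return_pmf (elapse 1 (set_var x (aval a e) e)))"
proof (rule sim_Dirac[where f = "\<lambda>\<sigma>. set_var x (aval a \<sigma>) \<sigma>"])
  fix qt \<sigma> assume *: "erase \<sigma> = erase e"
  show "exec ans qt (Assign x a) \<sigma> = return_spmf (elapse 1 (set_var x (aval a \<sigma>) \<sigma>)) \<and>
      erase (set_var x (aval a \<sigma>) \<sigma>) = erase (set_var x (aval a e) e)"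
    using * by (simp add: erase_eq_iff eval_erase_eq(1)[OF *])
qed auto

lemma sim_Store:
  "sim ans (Store a i x) e (return_pmf (elapse 1 (set_elem a (aval i e) (aval x e) e)))"
proof (rule sim_Dirac[where f = "\<lambda>\<sigma>. set_elem a (aval i \<sigma>) (aval x \<sigma>) \<sigma>"])
  fix qt \<sigma> assume *: "erase \<sigma> = erase e"
  show "exec ans qt (Store a i x) \<sigma> =
      return_spmf (elapse 1 (set_elem a (aval i \<sigma>) (aval x \<sigma>) \<sigma>)) \<and>
      erase (set_elem a (aval i \<sigma>) (aval x \<sigma>) \<sigma>) = erase (set_elem a (aval i e) (aval x e) e)"
    using * by (simp add: erase_eq_iff eval_erase_eq(1)[OF *])
qed auto

lemma sim_RAssign: "sim ans (RAssign x r) e (return_pmf (elapse 1 (set_rvar x (rval r e) e)))"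
proof (rule sim_Dirac[where f = "\<lambda>\<sigma>. set_rvar x (rval r \<sigma>) \<sigma>"])
  fix qt \<sigma> assume *: "erase \<sigma> = erase e"
  show "exec ans qt (RAssign x r) \<sigma> = return_spmf (elapse 1 (set_rvar x (rval r \<sigma>) \<sigma>)) \<and>
      erase (set_rvar x (rval r \<sigma>) \<sigma>) = erase (set_rvar x (rval r e) e)"
    using * by (simp add: erase_eq_iff eval_erase_eq(2)[OF *])
qed auto

lemma sim_Random:
  "sim ans (Random x a) e (map_pmf (\<lambda>n. elapse 1 (set_var x n e)) (pmf_of_set {0..aval a e}))"
  unfolding sim_def coupled_def
proof (intro conjI allI impI ballI)
  fix qt \<sigma> assume *: "erase \<sigma> = erase e"
  show "\<exists>J. exec ans qt (Random x a) \<sigma> = spmf_of_pmf (map_pmf fst J) \<and>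
     map_pmf (\<lambda>n. elapse 1 (set_var x n e)) (pmf_of_set {0..aval a e}) = map_pmf snd J \<and>
     (\<forall>x \<in> set_pmf J. erase (fst x) = erase (snd x)) \<and>
     (\<forall>K. query_time_le qt K \<longrightarrow>
        (\<integral>\<^sup>+ x. of_nat (run_time (fst x)) \<partial>measure_pmf J) \<le>
        of_nat (run_time \<sigma>) + K * (\<integral>\<^sup>+ x. of_nat (run_time (snd x) - run_time e) \<partial>measure_pmf J))"
    using * eval_erase_eq(1)[OF *, of a]
    by (intro exI[of _ "map_pmf (\<lambda>n. (elapse 1 (set_var x n \<sigma>), elapse 1 (set_var x n e)))
          (pmf_of_set {0..aval a e})"])
       (auto simp: erase_eq_iff pmf.map_comp o_def map_spmf_of_pmf[symmetric]
         simp del: map_spmf_of_pmf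
         dest: query_time_le_ge_1 intro!: add_left_mono)
qed auto

text \<open>Every sampled query time is coupled with the same idealised result, so the mean cost of
  the query is charged to a single step.\<close>

lemma sim_perform_query:
  assumes "\<And>qt \<sigma>. erase \<sigma> = erase e \<Longrightarrow> exec ans qt c \<sigma> = perform_query ans qt x q \<sigma>"
  shows "sim ans c e
    (return_pmf (elapse 1 (set_var x (ans q) (e\<lparr>num_queries := num_queries e + 1\<rparr>))))"
  unfolding sim_def coupled_def
proof (intro conjI allI impI ballI)
  fix qt \<sigma> assume *: "erase \<sigma> = erase e"
  let ?f = "\<lambda>\<sigma>::state. set_var x (ans q) (\<sigma>\<lparr>num_queries := num_queries \<sigma> + 1\<rparr>)"
  have time: "(\<integral>\<^sup>+ t. 1 + of_nat (run_time \<sigma>) + of_nat t \<partial>measure_pmf (qt q)) \<le>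
      of_nat (run_time \<sigma>) + K" if "query_time_le qt K" for K
  proof -
    have "(\<integral>\<^sup>+ t. 1 + of_nat (run_time \<sigma>) + of_nat t \<partial>measure_pmf (qt q)) =
      of_nat (run_time \<sigma>) + (1 + (\<integral>\<^sup>+ t. of_nat t \<partial>measure_pmf (qt q)))"
      by (subst nn_integral_add) (auto simp: ac_simps)
    also have "\<dots> \<le> of_nat (run_time \<sigma>) + K"
      using that by (intro add_left_mono) (auto simp: query_time_le_def)
    finally show ?thesis .
  qed
  show "\<exists>J. exec ans qt c \<sigma> = spmf_of_pmf (map_pmf fst J) \<and>
     return_pmf (elapse 1 (?f e)) = map_pmf snd J \<and>
     (\<forall>x \<in> set_pmf J. erase (fst x) = erase (snd x)) \<and>
     (\<forall>K. query_time_le qt K \<longrightarrow>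
        (\<integral>\<^sup>+ x. of_nat (run_time (fst x)) \<partial>measure_pmf J) \<le>
        of_nat (run_time \<sigma>) + K * (\<integral>\<^sup>+ x. of_nat (run_time (snd x) - run_time e) \<partial>measure_pmf J))"
    using * time assms[OF *]
    by (intro exI[of _ "map_pmf (\<lambda>t. (elapse (1 + t) (?f \<sigma>), elapse 1 (?f e))) (qt q)"])
       (auto simp: erase_eq_iff pmf.map_comp o_def perform_query_def map_pmf_const add.assoc ac_simps)
qed auto

lemma sim_QueryOut:
  "sim ans (QueryOut x v i) e (return_pmf (elapse 1 (set_var x (ans (OutEdge (aval v e) (aval i e)))
     (e\<lparr>num_queries := num_queries e + 1\<rparr>))))"
proof (rule sim_perform_query)
  fix qt \<sigma> assume *: "erase \<sigma> = erase e"
  show "exec ans qt (QueryOut x v i) \<sigma> =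
      perform_query ans qt x (OutEdge (aval v e) (aval i e)) \<sigma>"
    by (simp add: eval_erase_eq(1)[OF *])
qed

text \<open>The composite command \<open>cd\<close> is arbitrary so that the rule also covers the unfolding of a loop.\<close>

lemma sim_bind:
  assumes c: "sim ans c e M" and d: "\<And>e1. e1 \<in> set_pmf M \<Longrightarrow> sim ans d e1 (N e1)"
    and ex: "\<And>qt \<sigma>. erase \<sigma> = erase e \<Longrightarrow>
      exec ans qt cd \<sigma> = bind_spmf (exec ans qt c \<sigma>) (exec ans qt d)"
  shows "sim ans cd e (bind_pmf M N)"
  unfolding sim_def
proof (intro conjI allI impI)
  show "\<forall>e' \<in> set_pmf (bind_pmf M N). run_time e \<le> run_time e' \<and>
        num_queries e' + run_time e \<le> num_queries e + run_time e'"
  proof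
    fix e' assume "e' \<in> set_pmf (bind_pmf M N)"
    then obtain e1 where e1: "e1 \<in> set_pmf M" "e' \<in> set_pmf (N e1)" by auto
    have "run_time e \<le> run_time e1" "num_queries e1 + run_time e \<le> num_queries e + run_time e1"
      using c e1(1) unfolding sim_def by blast+
    moreover have "run_time e1 \<le> run_time e'"
        "num_queries e' + run_time e1 \<le> num_queries e1 + run_time e'"
      using d[OF e1(1)] e1(2) unfolding sim_def by blast+
    ultimately show "run_time e \<le> run_time e' \<and>
        num_queries e' + run_time e \<le> num_queries e + run_time e'" by linarith
  qed
  fix qt \<sigma> assume *: "erase \<sigma> = erase e"
  have "coupled qt \<sigma> (exec ans qt c \<sigma>) e M"
    using c * unfolding sim_def by blast
  then obtain J where J: "exec ans qt c \<sigma> = spmf_of_pmf (map_pmf fst J)" "M = map_pmf snd J"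
     "\<And>x. x \<in> set_pmf J \<Longrightarrow> erase (fst x) = erase (snd x)"
     "\<And>K. query_time_le qt K \<Longrightarrow>
        (\<integral>\<^sup>+ x. of_nat (run_time (fst x)) \<partial>measure_pmf J) \<le>
        of_nat (run_time \<sigma>) + K * (\<integral>\<^sup>+ x. of_nat (run_time (snd x) - run_time e) \<partial>measure_pmf J)"
    unfolding coupled_def by blast
  \<comment> \<open>For each pair in the support of \<open>J\<close> a coupling of the continuation
    is chosen; \<open>bind_pmf\<close> then glues them together.\<close>
  have "\<exists>J2. exec ans qt d (fst x) = spmf_of_pmf (map_pmf fst J2) \<and> N (snd x) = map_pmf snd J2 \<and>
     (\<forall>y \<in> set_pmf J2. erase (fst y) = erase (snd y)) \<and>
     (\<forall>K. query_time_le qt K \<longrightarrow>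
        (\<integral>\<^sup>+ y. of_nat (run_time (fst y)) \<partial>measure_pmf J2) \<le>
        of_nat (run_time (fst x)) +
          K * (\<integral>\<^sup>+ y. of_nat (run_time (snd y) - run_time (snd x)) \<partial>measure_pmf J2))"
    if "x \<in> set_pmf J" for x
  proof -
    have "snd x \<in> set_pmf M" using that J(2) by simp
    with d J(3)[OF that] show ?thesis unfolding sim_def coupled_def by blast
  qed
  then obtain J2 where J2: "\<And>x. x \<in> set_pmf J \<Longrightarrow> exec ans qt d (fst x) = spmf_of_pmf (map_pmf fst (J2 x))"
     "\<And>x. x \<in> set_pmf J \<Longrightarrow> N (snd x) = map_pmf snd (J2 x)"
     "\<And>x y. x \<in> set_pmf J \<Longrightarrow> y \<in> set_pmf (J2 x) \<Longrightarrow> erase (fst y) = erase (snd y)"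
     "\<And>x K. x \<in> set_pmf J \<Longrightarrow> query_time_le qt K \<Longrightarrow>
        (\<integral>\<^sup>+ y. of_nat (run_time (fst y)) \<partial>measure_pmf (J2 x)) \<le>
        of_nat (run_time (fst x)) +
          K * (\<integral>\<^sup>+ y. of_nat (run_time (snd y) - run_time (snd x)) \<partial>measure_pmf (J2 x))"
    by metis
  show "coupled qt \<sigma> (exec ans qt cd \<sigma>) e (bind_pmf M N)"
    unfolding coupled_def
  proof (rule exI[of _ "bind_pmf J J2"], intro conjI allI impI ballI)
    show "exec ans qt cd \<sigma> = spmf_of_pmf (map_pmf fst (bind_pmf J J2))"
      by (simp add: ex[OF *] J(1) map_bind_pmf bind_map_pmf spmf_of_pmf_bind)
         (intro bind_pmf_cong refl J2(1))
    show "bind_pmf M N = map_pmf snd (bind_pmf J J2)"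
      by (simp add: J(2) map_bind_pmf bind_map_pmf)
         (intro bind_pmf_cong refl J2(2))
    show "erase (fst x) = erase (snd x)" if "x \<in> set_pmf (bind_pmf J J2)" for x
      using that J2(3) by (auto simp del: split_paired_All)
    fix K assume K: "query_time_le qt K"
    have mono: "run_time e \<le> run_time (snd x)" if "x \<in> set_pmf J" for x
      using that c unfolding sim_def by (auto simp: J(2))
    have mono2: "run_time (snd x) \<le> run_time (snd y)" if "x \<in> set_pmf J" "y \<in> set_pmf (J2 x)" for x y
    proof -
      have "snd x \<in> set_pmf M" "snd y \<in> set_pmf (N (snd x))" using that by (auto simp: J(2) J2(2))
      thus ?thesis using d unfolding sim_def by blast
    qed
    \<comment> \<open>Idealised time never decreases along a run, so the truncated difference splits
      at the intermediate state.\<close>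
    have *: "(\<integral>\<^sup>+ y. of_nat (run_time (snd y) - run_time e) \<partial>measure_pmf (J2 x)) =
        (of_nat (run_time (snd x) - run_time e) :: ennreal) +
        (\<integral>\<^sup>+ y. of_nat (run_time (snd y) - run_time (snd x)) \<partial>measure_pmf (J2 x))" 
      if x: "x \<in> set_pmf J" for x
    proof -
      have "(\<integral>\<^sup>+ y. of_nat (run_time (snd y) - run_time e) \<partial>measure_pmf (J2 x)) =
        (\<integral>\<^sup>+ y. (of_nat (run_time (snd x) - run_time e) :: ennreal) +
           of_nat (run_time (snd y) - run_time (snd x)) \<partial>measure_pmf (J2 x))"
        using mono[OF x] mono2[OF x]
        by (intro nn_integral_cong_AE) (auto simp: AE_measure_pmf_iff simp flip: of_nat_add)
      also have "\<dots> = of_nat (run_time (snd x) - run_time e) +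
        (\<integral>\<^sup>+ y. of_nat (run_time (snd y) - run_time (snd x)) \<partial>measure_pmf (J2 x))"
        by (subst nn_integral_add) auto
      finally show ?thesis .
    qed
    let ?g = "\<lambda>x. \<integral>\<^sup>+ y. of_nat (run_time (snd y) - run_time (snd x)) \<partial>measure_pmf (J2 x)"
    have "(\<integral>\<^sup>+ x. of_nat (run_time (fst x)) \<partial>measure_pmf (bind_pmf J J2)) =
        (\<integral>\<^sup>+ x. \<integral>\<^sup>+ y. of_nat (run_time (fst y)) \<partial>measure_pmf (J2 x) \<partial>measure_pmf J)"
      by simp
    also have "\<dots> \<le> (\<integral>\<^sup>+ x. of_nat (run_time (fst x)) + K * ?g x \<partial>measure_pmf J)"
      using J2(4)[OF _ K] by (intro nn_integral_mono_AE) (auto simp: AE_measure_pmf_iff)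
    also have "\<dots> = (\<integral>\<^sup>+ x. of_nat (run_time (fst x)) \<partial>measure_pmf J) + K * (\<integral>\<^sup>+ x. ?g x \<partial>measure_pmf J)"
      by (subst nn_integral_add) (auto simp: nn_integral_cmult)
    also have "\<dots> \<le> of_nat (run_time \<sigma>) +
        K * (\<integral>\<^sup>+ x. of_nat (run_time (snd x) - run_time e) \<partial>measure_pmf J) + K * (\<integral>\<^sup>+ x. ?g x \<partial>measure_pmf J)"
      by (intro add_right_mono J(4) K)
    also have "\<dots> = of_nat (run_time \<sigma>) +
        K * (\<integral>\<^sup>+ x. of_nat (run_time (snd x) - run_time e) + ?g x \<partial>measure_pmf J)"
      by (subst nn_integral_add) (auto simp: distrib_left add.assoc)
    also have "(\<integral>\<^sup>+ x. of_nat (run_time (snd x) - run_time e) + ?g x \<partial>measure_pmf J) =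
       (\<integral>\<^sup>+ x. of_nat (run_time (snd x) - run_time e) \<partial>measure_pmf (bind_pmf J J2))"
      using * by (auto intro!: nn_integral_cong_AE simp: AE_measure_pmf_iff)
    finally show "(\<integral>\<^sup>+ x. of_nat (run_time (fst x)) \<partial>measure_pmf (bind_pmf J J2)) \<le>
        of_nat (run_time \<sigma>) + K * (\<integral>\<^sup>+ x. of_nat (run_time (snd x) - run_time e) \<partial>measure_pmf (bind_pmf J J2))" .
  qed
qed

lemma sim_Seq:
  assumes "sim ans c e M" and "\<And>e1. e1 \<in> set_pmf M \<Longrightarrow> sim ans d e1 (N e1)"
  shows "sim ans (Seq c d) e (bind_pmf M N)"
proof (rule sim_bind[OF assms(1)])
  fix qt \<sigma> assume "erase \<sigma> = erase e"
  show "exec ans qt (Seq c d) \<sigma> = bind_spmf (exec ans qt c \<sigma>) (exec ans qt d)"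
    by (rule exec.simps)
qed (rule assms(2))

text \<open>The step spent on the test is modelled by a \<open>Skip\<close> in front of the selected
  branch.\<close>

lemma sim_IfElse:
  assumes "sim ans (if bval b e then c else d) (elapse 1 e) M"
  shows "sim ans (IfElse b c d) e M"
proof -
  have "sim ans (IfElse b c d) e (bind_pmf (return_pmf (elapse 1 e)) (\<lambda>_. M))"
  proof (rule sim_bind[OF sim_Skip, where d = "if bval b e then c else d"])
    fix qt \<sigma> assume *: "erase \<sigma> = erase e"
    show "exec ans qt (IfElse b c d) \<sigma> =
        bind_spmf (exec ans qt Skip \<sigma>) (exec ans qt (if bval b e then c else d))"
      by (simp add: eval_erase_eq(3)[OF *])
  qed (use assms in simp)
  thus ?thesis by (simp add: bind_return_pmf)
qed

text \<open>One unfolding is a \<open>Skip\<close> that stands for the test, then the body, then the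
  loop again. The \<open>elapse 1\<close> outside the fixed point pays for the last test only, so it
  moves into the continuation.\<close>

lemma sim_While_True:
  assumes "bval b e" and "sim ans c (elapse 1 e) M"
    and "\<And>e1. e1 \<in> set_pmf M \<Longrightarrow> sim ans (While b c) e1 (N e1)"
  shows "sim ans (While b c) e (bind_pmf M N)"
proof (rule sim_bind[where c = "Seq Skip c"])
  show "sim ans (Seq Skip c) e M"
    using sim_Seq[OF sim_Skip, where N = "\<lambda>_. M" and d = c and ans = ans and e = e] assms(2) by (simp add: bind_return_pmf)
next
  fix qt \<sigma> assume *: "erase \<sigma> = erase e"
  show "exec ans qt (While b c) \<sigma> = bind_spmf (exec ans qt (Seq Skip c) \<sigma>) (exec ans qt (While b c))"
    using assms(1) eval_erase_eq(3)[OF *, of b]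
    by (simp add: while_spmf.simps[of _ _ \<sigma>] map_spmf_bind_spmf o_def)
       (intro bind_spmf_cong refl, simp)
qed (use assms in auto)

lemma sim_While_False:
  assumes "\<not> bval b e"
  shows "sim ans (While b c) e (return_pmf (elapse 1 e))"
proof -
  have "exec ans qt (While b c) \<sigma> = return_spmf (elapse 1 \<sigma>)" if "erase \<sigma> = erase e" for qt \<sigma>
    using assms eval_erase_eq(3)[OF that, of b] by (simp add: while_spmf.simps[of _ _ \<sigma>])
  thus ?thesis using sim_Dirac[of e ans "While b c" id] by simp
qed

section \<open>Triples for commands that make no random choice\<close>

definition det :: "(query \<Rightarrow> nat) \<Rightarrow> com \<Rightarrow> state \<Rightarrow> (state \<Rightarrow> bool) \<Rightarrow> bool" where
  "det ans c e Q \<longleftrightarrow> (\<exists>e'. sim ans c e (return_pmf e') \<and> Q e')"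

lemma det_Skip: "Q (elapse 1 e) \<Longrightarrow> det ans Skip e Q"
  unfolding det_def using sim_Skip by blast

lemma det_Assign: "Q (elapse 1 (set_var x (aval a e) e)) \<Longrightarrow> det ans (Assign x a) e Q"
  unfolding det_def using sim_Assign by blast

lemma det_Store: "Q (elapse 1 (set_elem a (aval i e) (aval x e) e)) \<Longrightarrow> det ans (Store a i x) e Q"
  unfolding det_def using sim_Store by blast

lemma det_RAssign: "Q (elapse 1 (set_rvar x (rval r e) e)) \<Longrightarrow> det ans (RAssign x r) e Q"
  unfolding det_def using sim_RAssign by blast

lemma det_QueryOut:
  "Q (elapse 1 (set_var x (ans (OutEdge (aval v e) (aval i e)))
     (e\<lparr>num_queries := num_queries e + 1\<rparr>))) \<Longrightarrow> det ans (QueryOut x v i) e Q"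
  unfolding det_def using sim_QueryOut by blast

lemma det_Seq: "det ans c e (\<lambda>e'. det ans d e' Q) \<Longrightarrow> det ans (Seq c d) e Q"
  unfolding det_def using sim_Seq[of ans c e "return_pmf _" d "\<lambda>_. return_pmf _"]
  by (simp add: bind_return_pmf) blast

lemma det_IfElse:
  "(bval b e \<Longrightarrow> det ans c (elapse 1 e) Q) \<Longrightarrow> (\<not> bval b e \<Longrightarrow> det ans d (elapse 1 e) Q) \<Longrightarrow>
   det ans (IfElse b c d) e Q"
  unfolding det_def by (cases "bval b e") (auto intro!: sim_IfElse)

lemma det_conseq: "det ans c e Q \<Longrightarrow> (\<And>e'. Q e' \<Longrightarrow> R e') \<Longrightarrow> det ans c e R"
  unfolding det_def by blast

text \<open>The index \<open>n\<close> is a variant that strictly decreases, so termination is part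
  of the conclusion.\<close>

lemma det_While:
  assumes "I (n::nat) e"
    and "\<And>n e. I n e \<Longrightarrow> bval b e \<Longrightarrow> det ans c (elapse 1 e) (\<lambda>e'. \<exists>m<n. I m e')"
    and "\<And>n e. I n e \<Longrightarrow> \<not> bval b e \<Longrightarrow> Q (elapse 1 e)"
  shows "det ans (While b c) e Q"
  using assms(1)
proof (induction n arbitrary: e rule: less_induct)
  case (less n)
  show ?case
  proof (cases "bval b e")
    case True
    from assms(2)[OF less.prems True] obtain e1 m where
      e1: "sim ans c (elapse 1 e) (return_pmf e1)" and m: "m < n" "I m e1" unfolding det_def by blast
    obtain e2 where e2: "sim ans (While b c) e1 (return_pmf e2)" "Q e2"
      using less.IH[OF m] unfolding det_def by blast
    show ?thesis
      using sim_While_True[OF True e1, of "\<lambda>_. return_pmf e2"] e2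
      unfolding det_def by (auto simp: bind_return_pmf)
  next
    case False
    with assms(3)[OF less.prems False] show ?thesis
      unfolding det_def using sim_While_False by blast
  qed
qed

section \<open>Triples for randomized commands: a sure postcondition and a bound on an expected
  potential\<close>

definition prob :: "(query \<Rightarrow> nat) \<Rightarrow> com \<Rightarrow> state \<Rightarrow> (state \<Rightarrow> bool) \<Rightarrow> (state \<Rightarrow> ennreal) \<Rightarrow> ennreal \<Rightarrow> bool"
  where "prob ans c e Q \<phi> u \<longleftrightarrow> (\<exists>M. sim ans c e M \<and> (\<forall>e' \<in> set_pmf M. Q e') \<and>
     (\<integral>\<^sup>+ e'. \<phi> e' \<partial>measure_pmf M) \<le> u)"

lemma prob_det: "det ans c e (\<lambda>e'. Q e' \<and> \<phi> e' \<le> u) \<Longrightarrow> prob ans c e Q \<phi> u"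
  unfolding det_def prob_def by fastforce

text \<open>\<open>\<psi>\<close> is the intermediate potential: its value at a state bounds the
  expected final \<open>\<phi>\<close> from there, and the bounds compose by the law of total
  expectation.\<close>

lemma prob_Seq:
  assumes "prob ans c e (\<lambda>e1. prob ans d e1 Q \<phi> (\<psi> e1)) \<psi> u"
  shows "prob ans (Seq c d) e Q \<phi> u"
proof -
  from assms obtain M where M: "sim ans c e M" "\<And>e1. e1 \<in> set_pmf M \<Longrightarrow> prob ans d e1 Q \<phi> (\<psi> e1)"
    "(\<integral>\<^sup>+ e'. \<psi> e' \<partial>measure_pmf M) \<le> u" unfolding prob_def by blast
  obtain N where N: "\<And>e1. e1 \<in> set_pmf M \<Longrightarrow> sim ans d e1 (N e1)"
     "\<And>e1 e'. e1 \<in> set_pmf M \<Longrightarrow> e' \<in> set_pmf (N e1) \<Longrightarrow> Q e'"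
     "\<And>e1. e1 \<in> set_pmf M \<Longrightarrow> (\<integral>\<^sup>+ e'. \<phi> e' \<partial>measure_pmf (N e1)) \<le> \<psi> e1"
    using M(2) unfolding prob_def by metis
  have "(\<integral>\<^sup>+ e'. \<phi> e' \<partial>measure_pmf (bind_pmf M N)) \<le> (\<integral>\<^sup>+ e'. \<psi> e' \<partial>measure_pmf M)"
    using N(3) by (auto intro!: nn_integral_mono_AE simp: AE_measure_pmf_iff)
  with M(3) have "(\<integral>\<^sup>+ e'. \<phi> e' \<partial>measure_pmf (bind_pmf M N)) \<le> u" by order
  with sim_Seq[OF M(1) N(1)] N(2) show ?thesis
    unfolding prob_def by (intro exI[of _ "bind_pmf M N"]) auto
qed

lemma prob_Seq_det:
  assumes "det ans c e (\<lambda>e1. prob ans d e1 Q \<phi> u)"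
  shows "prob ans (Seq c d) e Q \<phi> u"
  by (rule prob_Seq[where \<psi> = "\<lambda>_. u"], rule prob_det) (use assms in simp)

lemma prob_conseq:
  "prob ans c e Q \<phi> u \<Longrightarrow> (\<And>e'. Q e' \<Longrightarrow> Q' e') \<Longrightarrow> u \<le> u' \<Longrightarrow> prob ans c e Q' \<phi> u'"
  unfolding prob_def by (meson order.trans)

lemma prob_Random:
  assumes "\<And>n. n \<le> aval a e \<Longrightarrow> Q (elapse 1 (set_var x n e))"
    and "(\<Sum>n\<le>aval a e. \<phi> (elapse 1 (set_var x n e))) / of_nat (Suc (aval a e)) \<le> u"
  shows "prob ans (Random x a) e Q \<phi> u"
  unfolding prob_def using assms
  by (intro exI[of _ "map_pmf (\<lambda>n. elapse 1 (set_var x n e)) (pmf_of_set {0..aval a e})"] conjI sim_Random)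
     (auto simp: nn_integral_pmf_of_set atMost_atLeast0)

lemma prob_IfElse:
  "(bval b e \<Longrightarrow> prob ans c (elapse 1 e) Q \<phi> u) \<Longrightarrow> (\<not> bval b e \<Longrightarrow> prob ans d (elapse 1 e) Q \<phi> u) \<Longrightarrow>
   prob ans (IfElse b c d) e Q \<phi> u"
  unfolding prob_def by (cases "bval b e") (auto intro!: sim_IfElse)

text \<open>\<open>\<psi>\<close> is a supermartingale for the loop and dominates
  \<open>\<phi>\<close> at the exit. The variant decreases in every outcome, not just on average, so
  induction on it proves the claim.\<close>

lemma prob_While:
  assumes "I (n::nat) e"
    and "\<And>n e. I n e \<Longrightarrow> bval b e \<Longrightarrow> prob ans c (elapse 1 e) (\<lambda>e'. \<exists>m<n. I m e') \<psi> (\<psi> e)"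
    and "\<And>n e. I n e \<Longrightarrow> \<not> bval b e \<Longrightarrow> Q (elapse 1 e) \<and> \<phi> (elapse 1 e) \<le> \<psi> e"
  shows "prob ans (While b c) e Q \<phi> (\<psi> e)"
  using assms(1)
proof (induction n arbitrary: e rule: less_induct)
  case (less n)
  show ?case
  proof (cases "bval b e")
    case True
    from assms(2)[OF less.prems True] obtain M where
      M: "sim ans c (elapse 1 e) M" "\<And>e'. e' \<in> set_pmf M \<Longrightarrow> \<exists>m<n. I m e'"
        "(\<integral>\<^sup>+ e'. \<psi> e' \<partial>measure_pmf M) \<le> \<psi> e" unfolding prob_def by blast
    have "\<And>e1. e1 \<in> set_pmf M \<Longrightarrow> prob ans (While b c) e1 Q \<phi> (\<psi> e1)"
      using M(2) less.IH by blast
    then obtain N where N: "\<And>e1. e1 \<in> set_pmf M \<Longrightarrow> sim ans (While b c) e1 (N e1)"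
       "\<And>e1 e'. e1 \<in> set_pmf M \<Longrightarrow> e' \<in> set_pmf (N e1) \<Longrightarrow> Q e'"
       "\<And>e1. e1 \<in> set_pmf M \<Longrightarrow> (\<integral>\<^sup>+ e'. \<phi> e' \<partial>measure_pmf (N e1)) \<le> \<psi> e1"
      unfolding prob_def by metis
    have "(\<integral>\<^sup>+ e'. \<phi> e' \<partial>measure_pmf (bind_pmf M N)) \<le> (\<integral>\<^sup>+ e'. \<psi> e' \<partial>measure_pmf M)"
      using N(3) by (auto intro!: nn_integral_mono_AE simp: AE_measure_pmf_iff)
    with M(3) have "(\<integral>\<^sup>+ e'. \<phi> e' \<partial>measure_pmf (bind_pmf M N)) \<le> \<psi> e" by order
    with sim_While_True[OF True M(1) N(1)] N(2) show ?thesis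
      unfolding prob_def by (intro exI[of _ "bind_pmf M N"]) auto
  next
    case False
    with assms(3)[OF less.prems False] show ?thesis
      by (auto simp: prob_def intro!: exI[of _ "return_pmf (elapse 1 e)"] sim_While_False)
  qed
qed

text \<open>Transfer to real executions: an event that ignores \<open>run_time\<close> keeps its
  probability under the coupling, and a sure bound \<open>T\<close> on the steps becomes a bound on
  the expected time.\<close>

lemma sim_result:
  assumes "sim ans c e M" and P: "\<And>\<sigma>. P (erase \<sigma>) \<longleftrightarrow> P \<sigma>"
  shows "lossless_spmf (exec ans qt c e)"
    and "\<sigma> \<in> set_spmf (exec ans qt c e) \<Longrightarrow> \<exists>e' \<in> set_pmf M. erase \<sigma> = erase e'"
    and "measure (measure_spmf (exec ans qt c e)) {\<sigma>. P \<sigma>} = measure_pmf.prob M {\<sigma>. P \<sigma>}"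
    and "query_time_le qt K \<Longrightarrow> (\<And>e'. e' \<in> set_pmf M \<Longrightarrow> run_time e' - run_time e \<le> T) \<Longrightarrow>
      (\<integral>\<^sup>+ \<sigma>. of_nat (run_time \<sigma>) \<partial>measure_spmf (exec ans qt c e)) \<le> of_nat (run_time e) + K * of_nat T"
proof -
  have "coupled qt e (exec ans qt c e) e M"
    using assms unfolding sim_def by blast
  then obtain J where J: "exec ans qt c e = spmf_of_pmf (map_pmf fst J)" "M = map_pmf snd J"
     "\<And>x. x \<in> set_pmf J \<Longrightarrow> erase (fst x) = erase (snd x)"
     "\<And>K. query_time_le qt K \<Longrightarrow>
        (\<integral>\<^sup>+ x. of_nat (run_time (fst x)) \<partial>measure_pmf J) \<le>
        of_nat (run_time e) + K * (\<integral>\<^sup>+ x. of_nat (run_time (snd x) - run_time e) \<partial>measure_pmf J)"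
    unfolding coupled_def by blast
  show "lossless_spmf (exec ans qt c e)" by (simp add: J(1))
  show "\<exists>e' \<in> set_pmf M. erase \<sigma> = erase e'" if "\<sigma> \<in> set_spmf (exec ans qt c e)"
    using that J(3) by (fastforce simp: J(1,2) simp del: split_paired_All)
  have "P (fst x) \<longleftrightarrow> P (snd x)" if "x \<in> set_pmf J" for x
    using J(3)[OF that] P by metis
  hence "measure_pmf.prob J {x. P (fst x)} = measure_pmf.prob J {x. P (snd x)}"
    by (intro measure_pmf.finite_measure_eq_AE) (auto simp: AE_measure_pmf_iff)
  thus "measure (measure_spmf (exec ans qt c e)) {\<sigma>. P \<sigma>} = measure_pmf.prob M {\<sigma>. P \<sigma>}"
    by (simp add: J(1,2) vimage_def)
  assume K: "query_time_le qt K" and T: "\<And>e'. e' \<in> set_pmf M \<Longrightarrow> run_time e' - run_time e \<le> T"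
  have "(\<integral>\<^sup>+ x. of_nat (run_time (snd x) - run_time e) \<partial>measure_pmf J) \<le> (\<integral>\<^sup>+ x. of_nat T \<partial>measure_pmf J)"
    using T by (intro nn_integral_mono_AE) (auto simp: AE_measure_pmf_iff J(2))
  also have "\<dots> = of_nat T" by simp
  finally have "K * (\<integral>\<^sup>+ x. of_nat (run_time (snd x) - run_time e) \<partial>measure_pmf J) \<le> K * of_nat T"
    by (rule mult_left_mono) simp
  with J(4)[OF K] show "(\<integral>\<^sup>+ \<sigma>. of_nat (run_time \<sigma>) \<partial>measure_spmf (exec ans qt c e)) \<le>
      of_nat (run_time e) + K * of_nat T"
    by (simp add: J(1)) (meson add_left_mono order.trans)
qed

text \<open>In the main loop the factor \<open>a\<close> is the risk carried into the later trials;
  it multiplies the failure probability of the present one.\<close>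

lemma prob_mono_scale:
  assumes "prob ans c e Q \<phi> u" "\<And>e'. Q e' \<Longrightarrow> \<phi>' e' \<le> a * \<phi> e'" "a * u \<le> u'"
  shows "prob ans c e Q \<phi>' u'"
proof -
  from assms(1) obtain M where M: "sim ans c e M" "\<forall>e' \<in> set_pmf M. Q e'"
    "(\<integral>\<^sup>+ e'. \<phi> e' \<partial>measure_pmf M) \<le> u" unfolding prob_def by blast
  have "(\<integral>\<^sup>+ e'. \<phi>' e' \<partial>measure_pmf M) \<le> (\<integral>\<^sup>+ e'. a * \<phi> e' \<partial>measure_pmf M)"
    using assms(2) M(2) by (intro nn_integral_mono_AE) (auto simp: AE_measure_pmf_iff)
  also have "\<dots> = a * (\<integral>\<^sup>+ e'. \<phi> e' \<partial>measure_pmf M)" by (simp add: nn_integral_cmult)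
  also have "\<dots> \<le> a * u" by (rule mult_left_mono[OF M(3)]) simp
  finally show ?thesis using M assms(3) unfolding prob_def by (meson order.trans)
qed

section \<open>Residual graphs\<close>

text \<open>Edges are addressed by slots because reversals create loops and may create parallel
  edges. A slot keeps its tail while its head changes.\<close>

locale slotted_graph =
  fixes V :: "nat set" and deg :: "nat \<Rightarrow> nat" and head :: "nat \<Rightarrow> nat \<Rightarrow> nat" and s :: nat
  assumes finite_V: "finite V" and s_in_V: "s \<in> V"
    and head_in_V: "\<And>v i. v \<in> V \<Longrightarrow> i < deg v \<Longrightarrow> head v i \<in> V"
begin

definition slots :: "nat set \<Rightarrow> (nat \<times> nat) set" where
  "slots X = Sigma X (\<lambda>v. {..<deg v})"

definition leaving :: "(nat \<Rightarrow> nat \<Rightarrow> nat) \<Rightarrow> nat set \<Rightarrow> nat" where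
  "leaving \<tau> X = card {(v, i) \<in> slots X. \<tau> v i \<notin> X}"

definition leaving_except :: "(nat \<Rightarrow> nat \<Rightarrow> nat) \<Rightarrow> nat \<Rightarrow> nat \<Rightarrow> nat set \<Rightarrow> nat" where
  "leaving_except \<tau> u l X = card {(v, i) \<in> slots X. (v, i) \<noteq> (u, l) \<and> \<tau> v i \<notin> X}"

definition redirect :: "(nat \<Rightarrow> nat \<Rightarrow> nat) \<Rightarrow> nat \<Rightarrow> nat \<Rightarrow> nat \<Rightarrow> nat \<Rightarrow> nat \<Rightarrow> nat" where
  "redirect \<tau> u l y = \<tau>(u := (\<tau> u)(l := y))"

lemma redirect_apply: "redirect \<tau> u l y v i = (if v = u \<and> i = l then y else \<tau> v i)"
  by (simp add: redirect_def)

lemma finite_slots: "X \<subseteq> V \<Longrightarrow> finite (slots X)"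
  unfolding slots_def using finite_V by (auto intro: finite_subset)

lemma leaving_eq_leaving_except:
  assumes "X \<subseteq> V" "l < deg u"
  shows "leaving \<tau> X = leaving_except \<tau> u l X + of_bool (u \<in> X \<and> \<tau> u l \<notin> X)"
proof -
  let ?A = "{(v, i) \<in> slots X. (v, i) \<noteq> (u, l) \<and> \<tau> v i \<notin> X}"
  have fin: "finite ?A" by (rule finite_subset[OF _ finite_slots[OF assms(1)]]) auto
  have "{(v, i) \<in> slots X. \<tau> v i \<notin> X} =
    (if u \<in> X \<and> \<tau> u l \<notin> X then insert (u, l) ?A else ?A)"
    using assms(2) by (auto simp: slots_def)
  with fin show ?thesis unfolding leaving_def leaving_except_def by simp
qed

lemma leaving_redirect:
  assumes "X \<subseteq> V" "l < deg u"
  shows "leaving (redirect \<tau> u l y) X = leaving_except \<tau> u l X + of_bool (u \<in> X \<and> y \<notin> X)"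
proof -
  have "leaving_except (redirect \<tau> u l y) u l X = leaving_except \<tau> u l X"
    unfolding leaving_except_def by (rule arg_cong[of _ _ card]) (auto simp: redirect_apply)
  thus ?thesis using leaving_eq_leaving_except[OF assms, of "redirect \<tau> u l y"]
    by (simp add: redirect_apply)
qed

text \<open>
  While a tree path is being reversed from its end towards \<open>s\<close>, the slot \<open>(u, l)\<close> has lost its
  edge and the sum below does not change.
\<close>

lemma leaving_except_step:
  assumes "X \<subseteq> V" "l < deg u" "l' < deg u'" "u' \<noteq> u" "\<tau> u' l' = u"
  shows "leaving_except (redirect \<tau> u l u') u' l' X + of_bool (u' \<in> X) =
    leaving_except \<tau> u l X + of_bool (u \<in> X)"
  using leaving_eq_leaving_except[OF assms(1,3), of "redirect \<tau> u l u'"]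
    leaving_redirect[OF assms(1,2), of \<tau> u'] assms(4,5)
  by (auto simp: redirect_apply split: if_splits)

text \<open>
  After \<open>j\<close> reversals, the number of edges leaving \<open>X \<ni> s\<close> has dropped by the number of reversals
  whose drawn edge does not lie within \<open>X\<close>; this number is antitone in \<open>X\<close>.
\<close>

definition residual :: "(nat \<Rightarrow> nat \<Rightarrow> nat) \<Rightarrow> nat \<Rightarrow> bool" where
  "residual \<tau> j \<longleftrightarrow>
     (\<forall>v\<in>V. \<forall>i<deg v. \<tau> v i \<in> V) \<and>
     (\<forall>X. s \<in> X \<longrightarrow> X \<subseteq> V \<longrightarrow> leaving \<tau> X \<le> leaving head X \<and> leaving head X \<le> leaving \<tau> X + j) \<and>
     (\<forall>X Y. s \<in> X \<longrightarrow> X \<subseteq> Y \<longrightarrow> Y \<subseteq> V \<longrightarrow>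
        leaving head Y + leaving \<tau> X \<le> leaving head X + leaving \<tau> Y)"

lemma residual_head: "residual head 0"
  unfolding residual_def using head_in_V by auto

text \<open>The single drop at \<open>X\<close> is 0 or 1, and enlarging \<open>X\<close> can only
  bring \<open>u\<close> and \<open>w\<close> inside. So it is antitone in \<open>X\<close>, and
  adding it keeps the total drop antitone.\<close>

lemma residual_Suc:
  assumes "residual \<tau> j" and V: "\<And>v i. v \<in> V \<Longrightarrow> i < deg v \<Longrightarrow> \<tau>' v i \<in> V"
    and leave: "\<And>X. s \<in> X \<Longrightarrow> X \<subseteq> V \<Longrightarrow> leaving \<tau> X = leaving \<tau>' X + of_bool (u \<notin> X \<or> w \<notin> X)"
  shows "residual \<tau>' (Suc j)"
  unfolding residual_def
proof (intro conjI ballI allI impI)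
  fix X assume X: "s \<in> X" "X \<subseteq> V"
  have *: "leaving \<tau> X \<le> leaving head X" "leaving head X \<le> leaving \<tau> X + j"
    using assms(1) X unfolding residual_def by blast+
  have le1: "of_bool (u \<notin> X \<or> w \<notin> X) \<le> (1 :: nat)" by simp
  with leave[OF X] * show "leaving \<tau>' X \<le> leaving head X" "leaving head X \<le> leaving \<tau>' X + Suc j"
    by linarith+
next
  fix X Y assume "s \<in> X" and Y: "X \<subseteq> Y" "Y \<subseteq> V"
  hence X: "s \<in> X" "X \<subseteq> V" by auto
  have "of_bool (u \<notin> Y \<or> w \<notin> Y) \<le> (of_bool (u \<notin> X \<or> w \<notin> X) :: nat)"
    using Y by (auto simp: of_bool_def)
  moreover have "leaving head Y + leaving \<tau> X \<le> leaving head X + leaving \<tau> Y"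
    using assms(1) X Y unfolding residual_def by blast
  moreover have "leaving \<tau> Y = leaving \<tau>' Y + of_bool (u \<notin> Y \<or> w \<notin> Y)"
    using leave X Y by blast
  ultimately show "leaving head Y + leaving \<tau>' X \<le> leaving head X + leaving \<tau>' Y"
    using leave[OF X] by linarith
qed (use V in auto)

section \<open>Breadth-first search on a bounded number of slots\<close>

definition scanned :: "(nat \<Rightarrow> nat) \<Rightarrow> nat \<Rightarrow> nat \<Rightarrow> (nat \<times> nat) set" where
  "scanned Q h i = {(j, l). j < h \<and> l < deg (Q j) \<or> j = h \<and> l < i}"

text \<open>
  The queue is \<open>Q 0, \<dots>, Q (n - 1)\<close>; the slots of \<open>Q 0, \<dots>, Q (h - 1)\<close> and the first \<open>i\<close> slots of
  \<open>Q h\<close> have been scanned.  The vertex \<open>Q j\<close> was found in slot \<open>ps j\<close> of \<open>Q (pq j)\<close>, and the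
  \<open>x\<close>-th scanned slot is slot \<open>si x\<close> of \<open>Q (sq x)\<close>.
\<close>

definition search :: "(nat \<Rightarrow> nat \<Rightarrow> nat) \<Rightarrow> (nat \<Rightarrow> nat) \<Rightarrow> nat \<Rightarrow> (nat \<Rightarrow> nat) \<Rightarrow> (nat \<Rightarrow> nat) \<Rightarrow>
    (nat \<Rightarrow> nat) \<Rightarrow> (nat \<Rightarrow> nat) \<Rightarrow> nat \<Rightarrow> nat \<Rightarrow> nat \<Rightarrow> bool" where
  "search \<tau> Q n pq ps sq si h i t \<longleftrightarrow>
     0 < n \<and> Q 0 = s \<and> inj_on Q {..<n} \<and> Q ` {..<n} \<subseteq> V \<and>
     h \<le> n \<and> n \<le> t + 1 \<and> i \<le> t \<and> (h = n \<longrightarrow> i = 0) \<and> (h < n \<longrightarrow> i \<le> deg (Q h)) \<and>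
     (\<forall>j. 0 < j \<longrightarrow> j < n \<longrightarrow> pq j < j \<and> (pq j, ps j) \<in> scanned Q h i \<and> \<tau> (Q (pq j)) (ps j) = Q j) \<and>
     bij_betw (\<lambda>x. (sq x, si x)) {..<t} (scanned Q h i) \<and>
     (\<forall>(j, l) \<in> scanned Q h i. \<tau> (Q j) l \<in> Q ` {..<n})"

lemma search_init: "search \<tau> (Q(0 := s)) 1 pq ps sq si 0 0 0"
  unfolding search_def scanned_def using s_in_V by (auto simp: bij_betw_def inj_on_def)

lemma scanned_in_slots:
  assumes "search \<tau> Q n pq ps sq si h i t" "(j, l) \<in> scanned Q h i"
  shows "j < n" "l < deg (Q j)" "Q j \<in> V"
proof -
  show "j < n" using assms by (fastforce simp: search_def scanned_def)
  show "l < deg (Q j)" using assms by (fastforce simp: search_def scanned_def)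
  show "Q j \<in> V" using assms(1) \<open>j < n\<close> by (auto simp: search_def)
qed

lemma search_next_vertex:
  assumes "search \<tau> Q n pq ps sq si h i t" "h < n" "\<not> i < deg (Q h)"
  shows "search \<tau> Q n pq ps sq si (Suc h) 0 t"
proof -
  have i: "i = deg (Q h)" using assms by (auto simp: search_def)
  have "scanned Q (Suc h) 0 = scanned Q h i"
    by (auto simp: scanned_def i less_Suc_eq)
  with assms show ?thesis unfolding search_def by auto
qed

lemma scanned_Suc: "scanned Q h (Suc i) = insert (h, i) (scanned Q h i)"
  by (auto simp: scanned_def)

lemma search_scan:
  assumes S: "search \<tau> Q n pq ps sq si h i t" and "h < n" "i < deg (Q h)"
    and w: "\<tau> (Q h) i \<in> Q ` {..<n}"
  shows "search \<tau> Q n pq ps (sq(t := h)) (si(t := i)) h (Suc i) (Suc t)"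
proof -
  have bij: "bij_betw (\<lambda>x. (sq x, si x)) {..<t} (scanned Q h i)" using S by (simp add: search_def)
  have "bij_betw (\<lambda>x. ((sq(t := h)) x, (si(t := i)) x)) {..<t} (scanned Q h i)"
    using bij by (subst bij_betw_cong[where g = "\<lambda>x. (sq x, si x)"]) auto
  moreover have "(h, i) \<notin> scanned Q h i" by (auto simp: scanned_def)
  ultimately have "bij_betw (\<lambda>x. ((sq(t := h)) x, (si(t := i)) x)) (insert t {..<t}) (insert (h, i) (scanned Q h i))"
    using notIn_Un_bij_betw[of t "{..<t}" "\<lambda>x. ((sq(t := h)) x, (si(t := i)) x)" "scanned Q h i"] by auto
  moreover have "insert t {..<t} = {..<Suc t}" by auto
  ultimately have "bij_betw (\<lambda>x. ((sq(t := h)) x, (si(t := i)) x)) {..<Suc t} (scanned Q h (Suc i))"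
    by (simp add: scanned_Suc)
  with assms show ?thesis unfolding search_def scanned_Suc by auto
qed

lemma search_discover:
  assumes S: "search \<tau> Q n pq ps sq si h i t" and h: "h < n" and i: "i < deg (Q h)"
    and w: "\<tau> (Q h) i = w" "w \<notin> Q ` {..<n}" "w \<in> V"
  shows "search \<tau> (Q(n := w)) (Suc n) (pq(n := h)) (ps(n := i)) (sq(t := h)) (si(t := i)) h (Suc i) (Suc t)"
proof -
  let ?Q = "Q(n := w)"
  have bij: "bij_betw (\<lambda>x. (sq x, si x)) {..<t} (scanned Q h i)" using S by (simp add: search_def)
  have "bij_betw (\<lambda>x. ((sq(t := h)) x, (si(t := i)) x)) {..<t} (scanned Q h i)"
    using bij by (subst bij_betw_cong[where g = "\<lambda>x. (sq x, si x)"]) auto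
  moreover have "(h, i) \<notin> scanned Q h i" by (auto simp: scanned_def)
  ultimately have "bij_betw (\<lambda>x. ((sq(t := h)) x, (si(t := i)) x)) (insert t {..<t}) (insert (h, i) (scanned Q h i))"
    using notIn_Un_bij_betw[of t "{..<t}" "\<lambda>x. ((sq(t := h)) x, (si(t := i)) x)" "scanned Q h i"] by auto
  moreover have "insert t {..<t} = {..<Suc t}" by auto
  moreover have sc: "scanned ?Q h (Suc i) = insert (h, i) (scanned Q h i)"
    unfolding scanned_Suc[symmetric] using h by (auto simp: scanned_def)
  ultimately have bij': "bij_betw (\<lambda>x. ((sq(t := h)) x, (si(t := i)) x)) {..<Suc t} (scanned ?Q h (Suc i))"
    by simp
  have lt: "j < n" if "(j, l) \<in> scanned Q h i" for j l using scanned_in_slots[OF S that] by simp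
  have img: "?Q ` {..<Suc n} = insert w (Q ` {..<n})" by (auto simp: lessThan_Suc)
  have inj: "inj_on ?Q {..<Suc n}"
  proof -
    have "inj_on Q {..<n}" using S by (simp add: search_def)
    hence "inj_on ?Q {..<n}" using w(2) by (rule inj_on_fun_updI)
    moreover have "?Q ` ({..<n} - {n}) = Q ` {..<n}" by auto
    ultimately show ?thesis using w(2) by (simp add: lessThan_Suc)
  qed
  have tree: "(pq(n := h)) j < j \<and> ((pq(n := h)) j, (ps(n := i)) j) \<in> insert (h, i) (scanned Q h i) \<and>
     \<tau> (?Q ((pq(n := h)) j)) ((ps(n := i)) j) = ?Q j" if j: "0 < j" "j < Suc n" for j
  proof (cases "j = n")
    case True thus ?thesis using h w by auto
  next
    case False
    hence "j < n" using j by simp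
    hence "pq j < j \<and> (pq j, ps j) \<in> scanned Q h i \<and> \<tau> (Q (pq j)) (ps j) = Q j"
      using S j unfolding search_def by blast
    thus ?thesis using False \<open>j < n\<close> by auto
  qed
  have closed: "\<tau> (?Q j) l \<in> ?Q ` {..<Suc n}" if "(j, l) \<in> insert (h, i) (scanned Q h i)" for j l
    unfolding img using that
  proof
    assume "(j, l) = (h, i)" thus "\<tau> (?Q j) l \<in> insert w (Q ` {..<n})" using h w by auto
  next
    assume "(j, l) \<in> scanned Q h i"
    with lt[OF this] S show "\<tau> (?Q j) l \<in> insert w (Q ` {..<n})" unfolding search_def by fastforce
  qed
  have "0 < n" "Q 0 = s" "Q ` {..<n} \<subseteq> V" "n \<le> t + 1" "i \<le> t" using S by (auto simp: search_def)
  note S' = this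
  show ?thesis
    unfolding search_def
  proof (intro conjI allI impI)
    show "\<forall>(j, l) \<in> scanned ?Q h (Suc i). \<tau> (?Q j) l \<in> ?Q ` {..<Suc n}"
      unfolding sc using closed by blast
    fix j assume j: "0 < j" "j < Suc n"
    show "(pq(n := h)) j < j" "\<tau> (?Q ((pq(n := h)) j)) ((ps(n := i)) j) = ?Q j"
      using tree[OF j] by blast+
    show "((pq(n := h)) j, (ps(n := i)) j) \<in> scanned ?Q h (Suc i)"
      unfolding sc using tree[OF j] by blast
  next
    show "?Q ` {..<Suc n} \<subseteq> V" unfolding img using S'(3) w(3) by simp
  qed (use S' h i bij' inj in simp_all)
qed

lemma card_scanned:
  assumes S: "search \<tau> Q n pq ps sq si h i t"
  shows "inj_on (\<lambda>x. (Q (sq x), si x)) {..<t}" "\<And>x. x < t \<Longrightarrow> (sq x, si x) \<in> scanned Q h i"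
proof -
  have bij: "bij_betw (\<lambda>x. (sq x, si x)) {..<t} (scanned Q h i)" using S by (simp add: search_def)
  thus mem: "\<And>x. x < t \<Longrightarrow> (sq x, si x) \<in> scanned Q h i" by (auto simp: bij_betw_def)
  show "inj_on (\<lambda>x. (Q (sq x), si x)) {..<t}"
  proof (rule inj_onI)
    fix x y assume xy: "x \<in> {..<t}" "y \<in> {..<t}" "(Q (sq x), si x) = (Q (sq y), si y)"
    have "inj_on Q {..<n}" using S by (simp add: search_def)
    moreover have "sq x < n" "sq y < n" using scanned_in_slots[OF S mem] xy by auto
    ultimately have "(sq x, si x) = (sq y, si y)" using xy by (auto dest: inj_onD)
    thus "x = y" using bij xy unfolding bij_betw_def by (auto dest: inj_onD)
  qed
qed

text \<open>Different scan indices denote different slots. This is what makes a uniform draw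
  unlikely to start in a small \<open>C\<close>.\<close>

lemma card_scanned_from:
  assumes S: "search \<tau> Q n pq ps sq si h i t" and C: "C \<subseteq> V"
  shows "card {x. x < t \<and> Q (sq x) \<in> C} \<le> card (slots C)"
proof (rule card_inj_on_le[OF _ _ finite_slots[OF C]])
  show "inj_on (\<lambda>x. (Q (sq x), si x)) {x. x < t \<and> Q (sq x) \<in> C}"
    using card_scanned(1)[OF S] by (rule inj_on_subset) auto
  show "(\<lambda>x. (Q (sq x), si x)) ` {x. x < t \<and> Q (sq x) \<in> C} \<subseteq> slots C"
    using scanned_in_slots[OF S card_scanned(2)[OF S]] by (auto simp: slots_def)
qed

text \<open>No residual edge leaves \<open>C\<close>, so by induction along the tree predecessors
  every queued vertex lies in \<open>C\<close>.\<close>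

lemma search_confined:
  assumes S: "search \<tau> Q n pq ps sq si h i t" and C: "C \<subseteq> V" "s \<in> C" and "leaving \<tau> C = 0"
  shows "t \<le> card (slots C)"
proof -
  have "finite {(v, i) \<in> slots C. \<tau> v i \<notin> C}"
    by (rule finite_subset[OF _ finite_slots[OF C(1)]]) auto
  with assms(4) have none: "\<tau> v i \<in> C" if "v \<in> C" "i < deg v" for v i
    using that by (auto simp: leaving_def slots_def)
  have "Q j \<in> C" if "j < n" for j using that
  proof (induction j rule: less_induct)
    case (less j)
    show ?case
    proof (cases "j = 0")
      case True thus ?thesis using S C by (simp add: search_def)
    next
      case False
      with less.prems S have "pq j < j" "(pq j, ps j) \<in> scanned Q h i" "\<tau> (Q (pq j)) (ps j) = Q j"
        unfolding search_def by auto
      with less.IH[of "pq j"] less.prems none scanned_in_slots[OF S this(2)] show ?thesis by force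
    qed
  qed
  hence "{x. x < t \<and> Q (sq x) \<in> C} = {..<t}"
    using scanned_in_slots[OF S card_scanned(2)[OF S]] by auto
  with card_scanned_from[OF S C(1)] show ?thesis by simp
qed

text \<open>The queue is exhausted, so no residual edge leaves \<open>U\<close>, and
  \<open>j\<close> reversals account for all original edges leaving it. A smaller \<open>X\<close>
  is left by some tree edge; as drops are antitone, the strict inequality carries back to the
  original graph.\<close>

lemma search_complete:
  assumes S: "search \<tau> Q n pq ps sq si n i t" and R: "residual \<tau> j"
  defines "U \<equiv> Q ` {..<n}"
  shows "s \<in> U" "U \<subseteq> V" "leaving head U \<le> j" "card (slots U) = t"
    and "\<And>X. s \<in> X \<Longrightarrow> X \<subset> U \<Longrightarrow> leaving head U < leaving head X"
proof -
  have S': "0 < n" "Q 0 = s" "inj_on Q {..<n}" "U \<subseteq> V" "i = 0" 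
    "bij_betw (\<lambda>x. (sq x, si x)) {..<t} (scanned Q n i)"
    "\<And>j l. (j, l) \<in> scanned Q n i \<Longrightarrow> \<tau> (Q j) l \<in> Q ` {..<n}"
    using S unfolding search_def U_def by auto
  show U: "s \<in> U" "U \<subseteq> V" using S' by (auto simp: U_def)
  have "{(v, i) \<in> slots U. \<tau> v i \<notin> U} = {}"
    using S'(7) by (auto simp: slots_def U_def scanned_def)
  hence 0: "leaving \<tau> U = 0" unfolding leaving_def by (simp only: card.empty)
  with R U show "leaving head U \<le> j" unfolding residual_def by fastforce
  \<comment> \<open>With \<open>i = 0\<close> at queue position \<open>n\<close>, the scanned
    positions are exactly the slots of the queued vertices.\<close>
  have "bij_betw (\<lambda>(j, l). (Q j, l)) (scanned Q n i) (slots U)"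
  proof (rule bij_betw_imageI)
    show "inj_on (\<lambda>(j, l). (Q j, l)) (scanned Q n i)"
      using S'(3,5) by (auto simp: inj_on_def scanned_def)
    show "(\<lambda>(j, l). (Q j, l)) ` scanned Q n i = slots U"
      using S'(5) by (auto simp: scanned_def slots_def U_def image_iff)
  qed
  from bij_betw_same_card[OF this] bij_betw_same_card[OF S'(6)] show "card (slots U) = t" by simp
  fix X assume X: "s \<in> X" "X \<subset> U"
  obtain y where y: "y < n" "Q y \<notin> X" using X by (auto simp: U_def)
  \<comment> \<open>The first queued vertex outside \<open>X\<close> has its predecessor inside, so
    its tree edge leaves \<open>X\<close>.\<close>
  define x where "x = (LEAST y. y < n \<and> Q y \<notin> X)"
  have x: "x < n" "Q x \<notin> X"
    using LeastI[of "\<lambda>y. y < n \<and> Q y \<notin> X" y] y unfolding x_def by auto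
  have "x \<noteq> 0" using x S' X by auto
  with x S have p: "pq x < x" "(pq x, ps x) \<in> scanned Q n i" "\<tau> (Q (pq x)) (ps x) = Q x"
    unfolding search_def by auto
  have "Q (pq x) \<in> X"
    using not_less_Least[of "pq x" "\<lambda>y. y < n \<and> Q y \<notin> X"] p(1) x(1) unfolding x_def[symmetric] by auto
  hence "(Q (pq x), ps x) \<in> {(v, i) \<in> slots X. \<tau> v i \<notin> X}"
    using scanned_in_slots[OF S p(2)] x p(3) by (auto simp: slots_def)
  moreover have "finite {(v, i) \<in> slots X. \<tau> v i \<notin> X}"
    using X U by (intro finite_subset[OF _ finite_slots[of U]]) (auto simp: slots_def)
  ultimately have "0 < leaving \<tau> X" unfolding leaving_def by (auto simp: card_gt_0_iff)
  moreover have "leaving head U + leaving \<tau> X \<le> leaving head X + leaving \<tau> U"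
    using R X U unfolding residual_def by blast
  ultimately show "leaving head U < leaving head X" using 0 by simp
qed

end

section \<open>Representation of a residual graph in memory\<close>

text \<open>
  If \<open>B \<le> base v\<close>, the cells \<open>base v, \<dots>, base v + N - 1\<close> of \<open>ov\<close> belong to \<open>v\<close>: a non-zero entry
  at \<open>base v + i\<close> overrides the \<open>i\<close>-th outgoing edge of \<open>v\<close>.  Raising \<open>B\<close> to \<open>nxt\<close> discards all
  overrides at once.
\<close>

definition fresh :: "nat \<Rightarrow> (nat \<Rightarrow> nat) \<Rightarrow> (nat \<Rightarrow> nat) \<Rightarrow> bool" where
  "fresh nxt base ov \<longleftrightarrow> 0 < nxt \<and> (\<forall>v. base v < nxt) \<and> (\<forall>c\<ge>nxt. ov c = 0)"

definition cell_value :: "nat \<Rightarrow> (nat \<Rightarrow> nat) \<Rightarrow> (nat \<Rightarrow> nat) \<Rightarrow> (nat \<Rightarrow> nat \<Rightarrow> nat) \<Rightarrow> nat \<Rightarrow> nat \<Rightarrow> nat" where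
  "cell_value B base ov orig v i =
     (if B \<le> base v \<and> ov (base v + i) \<noteq> 0 then ov (base v + i) else orig v i)"

text \<open>\<open>orig\<close> and \<open>val\<close> give words, with 0 for a missing edge. Only
  slots below \<open>N\<close> are represented, as a search reads no others. Because of
  \<open>0 < B\<close>, the initial base 0 means that no block has been allocated.\<close>

definition stores :: "nat \<Rightarrow> nat \<Rightarrow> nat \<Rightarrow> (nat \<Rightarrow> nat) \<Rightarrow> (nat \<Rightarrow> nat) \<Rightarrow> (nat \<Rightarrow> nat \<Rightarrow> nat) \<Rightarrow>
    (nat \<Rightarrow> nat \<Rightarrow> nat) \<Rightarrow> bool" where
  "stores N B nxt base ov orig val \<longleftrightarrow> fresh nxt base ov \<and> 0 < B \<and> B \<le> nxt \<and>
     (\<forall>v. B \<le> base v \<longrightarrow> base v + N \<le> nxt) \<and>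
     (\<forall>u v. u \<noteq> v \<longrightarrow> B \<le> base u \<longrightarrow> B \<le> base v \<longrightarrow> base u + N \<le> base v \<or> base v + N \<le> base u) \<and>
     (\<forall>v. \<forall>i<N. cell_value B base ov orig v i = val v i)"

lemma stores_init: "fresh nxt base ov \<Longrightarrow> stores N nxt nxt base ov orig orig"
  unfolding stores_def fresh_def cell_value_def by (auto dest: leD)

text \<open>The cells from \<open>nxt\<close> on are still zero, so a new block overrides
  nothing.\<close>

lemma stores_allocate:
  assumes "stores N B nxt base ov orig val" "\<not> B \<le> base v" "0 < N"
  shows "stores N B (nxt + N) (base(v := nxt)) ov orig val"
proof -
  have S: "fresh nxt base ov" "0 < B" "B \<le> nxt" "\<And>v. B \<le> base v \<Longrightarrow> base v + N \<le> nxt"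
    "\<And>u v. u \<noteq> v \<Longrightarrow> B \<le> base u \<Longrightarrow> B \<le> base v \<Longrightarrow> base u + N \<le> base v \<or> base v + N \<le> base u"
    "\<And>v i. i < N \<Longrightarrow> cell_value B base ov orig v i = val v i"
    using assms(1) unfolding stores_def by blast+
  have "cell_value B (base(v := nxt)) ov orig u i = val u i" if "i < N" for u i
    using S(1) S(6)[OF that, of u] assms(2) unfolding cell_value_def fresh_def by auto
  moreover have "fresh (nxt + N) (base(v := nxt)) ov"
    using S(1) assms(3) unfolding fresh_def by (auto intro: trans_less_add1)
  moreover have "(base(v := nxt)) u + N \<le> nxt + N" if "B \<le> (base(v := nxt)) u" for u
    using S(4)[of u] that by (auto split: if_splits)
  moreover have "(base(v := nxt)) u + N \<le> (base(v := nxt)) w \<or> (base(v := nxt)) w + N \<le> (base(v := nxt)) u"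
    if "u \<noteq> w" "B \<le> (base(v := nxt)) u" "B \<le> (base(v := nxt)) w" for u w
    using S(4)[of u] S(4)[of w] S(5)[of u w] that by (auto split: if_splits)
  ultimately show ?thesis using S(2,3) unfolding stores_def by (simp add: trans_le_add1)
qed

text \<open>Blocks are disjoint, so writing one cell changes one slot. The word must be positive,
  since a zero cell would expose the original edge.\<close>

lemma stores_override:
  assumes "stores N B nxt base ov orig val" "B \<le> base v" "i < N" "0 < y"
  shows "stores N B nxt base (ov(base v + i := y)) orig (val(v := (val v)(i := y)))"
proof -
  have neq: "base u + l \<noteq> base v + i" if "B \<le> base u" "l < N" "u \<noteq> v \<or> l \<noteq> i" for u l
  proof (cases "u = v")
    case False
    hence "base u + N \<le> base v \<or> base v + N \<le> base u"
      using assms that unfolding stores_def by blast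
    thus ?thesis using that assms(3) by linarith
  qed (use that in simp)
  have lt: "base v + i < nxt" using assms unfolding stores_def by fastforce
  have "cell_value B base (ov(base v + i := y)) orig u l = (val(v := (val v)(i := y))) u l"
    if l: "l < N" for u l
  proof -
    have "cell_value B base ov orig u l = val u l" using assms l unfolding stores_def by blast
    thus ?thesis using neq[OF _ l, of u] assms unfolding cell_value_def by auto
  qed
  with lt assms show ?thesis unfolding stores_def fresh_def by auto
qed

section \<open>The program\<close>

text \<open>
  \<open>vB\<close> and \<open>vNxt\<close> delimit the override cells of the current attempt, \<open>vJ\<close> counts rounds, \<open>vCnt\<close> is
  the length of the queue, \<open>vH\<close> and \<open>vI\<close> are the queue position and the slot to be scanned next,
  \<open>vT\<close> counts scanned slots, \<open>vR\<close> and \<open>vL\<close> are the queue position and the slot of the edge to be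
  reversed next, and \<open>vF\<close> is set after success.
\<close>

abbreviation (input) "vK \<equiv> (0::nat)"
abbreviation (input) "vD \<equiv> (1::nat)"
abbreviation (input) "vS \<equiv> (2::nat)"
abbreviation (input) "vN \<equiv> (3::nat)"
abbreviation (input) "vB \<equiv> (4::nat)"
abbreviation (input) "vNxt \<equiv> (5::nat)"
abbreviation (input) "vJ \<equiv> (6::nat)"
abbreviation (input) "vCnt \<equiv> (7::nat)"
abbreviation (input) "vH \<equiv> (8::nat)"
abbreviation (input) "vI \<equiv> (9::nat)"
abbreviation (input) "vT \<equiv> (10::nat)"
abbreviation (input) "vR \<equiv> (11::nat)"
abbreviation (input) "vL \<equiv> (12::nat)"
abbreviation (input) "vV \<equiv> (13::nat)"
abbreviation (input) "vX \<equiv> (14::nat)"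
abbreviation (input) "vF \<equiv> (15::nat)"

abbreviation (input) "aQ \<equiv> (0::nat)"
abbreviation (input) "aPos \<equiv> (1::nat)"
abbreviation (input) "aBase \<equiv> (2::nat)"
abbreviation (input) "aOv \<equiv> (3::nat)"
abbreviation (input) "aPq \<equiv> (4::nat)"
abbreviation (input) "aPs \<equiv> (5::nat)"
abbreviation (input) "aSq \<equiv> (6::nat)"
abbreviation (input) "aSs \<equiv> (7::nat)"

notation (input) Seq (infixr ";;" 60)

text \<open>\<open>N\<close> is built by \<open>k + 1\<close> additions, since words cannot be
  multiplied. Real variable 0 becomes \<open>1 - p\<close>. Cells are handed out from 1 on, so that
  the zero-initialised \<open>aBase\<close> reads as unallocated.\<close>

definition init_code :: com where
  "init_code =
     RAssign 0 (RMinus ROne (RVar 0)) ;;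
     While (Le (Var vJ) (Var vK))
       (Assign vN (Plus (Var vN) (Plus (Plus (Var vD) (Var vK)) (Plus (Var vD) (Var vK)))) ;;
        Assign vJ (Plus (Var vJ) (Const 1))) ;;
     Assign vNxt (Const 1)"

text \<open>A block is allocated when a vertex is first read, and the graph is queried only where no
  override is present. The query index is shifted because incidence lists count from 1.\<close>

definition read_slot :: com where
  "read_slot =
     Assign vV (Elem aQ (Var vH)) ;;
     IfElse (Le (Var vB) (Elem aBase (Var vV))) Skip
       (Store aBase (Var vV) (Var vNxt) ;; Assign vNxt (Plus (Var vNxt) (Var vN))) ;;
     Assign vX (Elem aOv (Plus (Elem aBase (Var vV)) (Var vI))) ;;
     IfElse (Le (Const 1) (Var vX)) Skip (QueryOut vX (Var vV) (Plus (Var vI) (Const 1)))"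

text \<open>
  The vertex \<open>x\<close> is in the queue iff \<open>pos x\<close> is an index of the queue and \<open>x\<close> is found there; hence
  the arrays need no clearing between searches.
\<close>

definition scan_slot :: com where
  "scan_slot =
     Assign vX (Minus (Var vX) (Const 1)) ;;
     Store aSq (Var vT) (Var vH) ;;
     Store aSs (Var vT) (Var vI) ;;
     IfElse (Conj (Neg (Le (Var vCnt) (Elem aPos (Var vX))))
         (Conj (Le (Elem aQ (Elem aPos (Var vX))) (Var vX)) (Le (Var vX) (Elem aQ (Elem aPos (Var vX))))))
       Skip
       (Store aQ (Var vCnt) (Var vX) ;;
        Store aPos (Var vX) (Var vCnt) ;;
        Store aPq (Var vCnt) (Var vH) ;;
        Store aPs (Var vCnt) (Var vI) ;;
        Assign vCnt (Plus (Var vCnt) (Const 1))) ;;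
     Assign vT (Plus (Var vT) (Const 1)) ;;
     Assign vI (Plus (Var vI) (Const 1))"

definition search_step :: com where
  "search_step =
     read_slot ;;
     IfElse (Le (Const 1) (Var vX)) scan_slot
       (Assign vH (Plus (Var vH) (Const 1)) ;; Assign vI (Const 0))"

definition search_code :: com where
  "search_code =
     Store aQ (Const 0) (Var vS) ;;
     Store aPos (Var vS) (Const 0) ;;
     Assign vCnt (Const 1) ;;
     Assign vH (Const 0) ;;
     Assign vI (Const 0) ;;
     Assign vT (Const 0) ;;
     While (Conj (Neg (Le (Var vCnt) (Var vH))) (Neg (Le (Var vN) (Var vT)))) search_step"

text \<open>\<open>vR\<close> first holds a scan index and only then a queue position, so
  \<open>vL\<close> has to be read before it is overwritten. Afterwards \<open>vL\<close> is always
  a slot of the vertex at position \<open>vR\<close>.\<close>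

definition reverse_code :: com where
  "reverse_code =
     Assign vL (Elem aSs (Var vR)) ;;
     Assign vR (Elem aSq (Var vR)) ;;
     While (Le (Const 1) (Var vR))
       (Store aOv (Plus (Elem aBase (Elem aQ (Var vR))) (Var vL))
          (Plus (Elem aQ (Elem aPq (Var vR))) (Const 1)) ;;
        Assign vL (Elem aPs (Var vR)) ;;
        Assign vR (Elem aPq (Var vR))) ;;
     Store aOv (Plus (Elem aBase (Elem aQ (Var vR))) (Var vL)) (Plus (Var vS) (Const 1))"

definition round_code :: com where
  "round_code =
     search_code ;;
     IfElse (Le (Var vN) (Var vT))
       (Random vR (Minus (Var vN) (Const 1)) ;; reverse_code)
       (Assign vF (Const 1)) ;;
     Assign vJ (Plus (Var vJ) (Const 1))"

definition attempt_code :: com where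
  "attempt_code =
     Assign vB (Var vNxt) ;;
     Assign vJ (Const 0) ;;
     While (Conj (Le (Var vJ) (Var vK)) (Le (Var vF) (Const 0))) round_code"

text \<open>For \<open>p \<le> 0\<close> the loop is not entered and the empty set is returned.
  Variable 0, which held \<open>k\<close>, finally receives the length of the output list.\<close>

definition local_search :: com where
  "local_search =
     init_code ;;
     While (Conj (Neg (RLe ROne (RVar 0))) (Le (Var vF) (Const 0)))
       (RAssign 0 (RPlus (RVar 0) (RVar 0)) ;; attempt_code) ;;
     IfElse (Le (Const 1) (Var vF)) (Assign 0 (Var vCnt)) (Assign 0 (Const 0))"

lemmas det_intros = det_Seq det_Skip det_Assign det_Store det_RAssign det_QueryOut det_IfElse

section \<open>Correctness of the search and of the reversal\<close>

locale local_search_problem = slotted_graph +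
  fixes k \<Delta> N :: nat and ans :: "query \<Rightarrow> nat"
  assumes N_eq: "N = 2 * (k + 1) * (\<Delta> + k)" and \<Delta>_pos: "1 \<le> \<Delta>"
    and ans: "\<And>v i. ans (OutEdge v (Suc i)) = (if i < deg v then Suc (head v i) else 0)"
begin

lemma N_ge_2: "2 \<le> N" using \<Delta>_pos by (simp add: N_eq)

definition word_of :: "(nat \<Rightarrow> nat \<Rightarrow> nat) \<Rightarrow> nat \<Rightarrow> nat \<Rightarrow> nat" where
  "word_of \<tau> v i = (if i < deg v then Suc (\<tau> v i) else 0)"

lemma word_of_redirect:
  "l < deg u \<Longrightarrow> word_of (redirect \<tau> u l y) = (word_of \<tau>)(u := (word_of \<tau> u)(l := Suc y))"
  by (auto simp: word_of_def redirect_def fun_eq_iff)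

definition env :: "nat \<Rightarrow> nat \<Rightarrow> real \<Rightarrow> state \<Rightarrow> bool" where
  "env j f x e \<longleftrightarrow> vars e vK = k \<and> vars e vS = s \<and> vars e vN = N \<and> vars e vJ = j \<and> vars e vF = f \<and>
     rvars e 0 = x"

definition mem :: "(nat \<Rightarrow> nat \<Rightarrow> nat) \<Rightarrow> state \<Rightarrow> bool" where
  "mem \<tau> e \<longleftrightarrow> stores N (vars e vB) (vars e vNxt) (arrays e aBase) (arrays e aOv)
     (word_of head) (word_of \<tau>)"

text \<open>\<open>aPos\<close> is constrained on queued vertices only; elsewhere it may be stale.
  The last clause guarantees that every scanned slot already has a cell, so a reversal can write to
  it directly.\<close>

definition searching :: "(nat \<Rightarrow> nat \<Rightarrow> nat) \<Rightarrow> state \<Rightarrow> bool" where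
  "searching \<tau> e \<longleftrightarrow>
     search \<tau> (arrays e aQ) (vars e vCnt) (arrays e aPq) (arrays e aPs) (arrays e aSq) (arrays e aSs)
       (vars e vH) (vars e vI) (vars e vT) \<and>
     (\<forall>j < vars e vCnt. arrays e aPos (arrays e aQ j) = j) \<and> vars e vT \<le> N \<and>
     (\<forall>(j, l) \<in> scanned (arrays e aQ) (vars e vH) (vars e vI).
        l < N \<and> vars e vB \<le> arrays e aBase (arrays e aQ j))"

lemma read_slot:
  assumes "env j f x e" "mem \<tau> e" "searching \<tau> e" "vars e vH < vars e vCnt" "vars e vT < N"
  shows "det ans read_slot e (\<lambda>e'. env j f x e' \<and> mem \<tau> e' \<and> searching \<tau> e' \<and>
    vars e' vH = vars e vH \<and> vars e' vCnt = vars e vCnt \<and> vars e' vT = vars e vT \<and>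
    vars e' vI = vars e vI \<and> arrays e' aQ = arrays e aQ \<and>
    vars e' vB \<le> arrays e' aBase (arrays e aQ (vars e vH)) \<and>
    vars e' vX = word_of \<tau> (arrays e aQ (vars e vH)) (vars e vI) \<and> run_time e' \<le> run_time e + 10)"
proof -
  let ?v = "arrays e aQ (vars e vH)" and ?i = "vars e vI"
  \<comment> \<open>The slot index is at most the number of scanned slots, which is still below
    \<open>N\<close>.\<close>
  have i: "?i < N" using assms(3,5) by (auto simp: searching_def search_def)
  have N: "0 < N" using N_ge_2 by simp
  have ans': "ans (OutEdge v (Suc i)) = word_of head v i" for v i by (simp add: ans word_of_def)
  have st: "stores N (vars e vB) (vars e vNxt) (arrays e aBase) (arrays e aOv) (word_of head) (word_of \<tau>)"
    using assms(2) by (simp add: mem_def)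
  have old: "cell_value (vars e vB) (arrays e aBase) (arrays e aOv) (word_of head) ?v ?i = word_of \<tau> ?v ?i"
    using st i unfolding stores_def by blast
  show ?thesis
  proof (cases "vars e vB \<le> arrays e aBase ?v")
    case True
    have "vars e vB \<le> arrays e aBase ?v \<Longrightarrow> arrays e aOv (arrays e aBase ?v + ?i) \<noteq> 0 \<Longrightarrow>
       arrays e aOv (arrays e aBase ?v + ?i) = word_of \<tau> ?v ?i"
       "arrays e aOv (arrays e aBase ?v + ?i) = 0 \<Longrightarrow> word_of head ?v ?i = word_of \<tau> ?v ?i"
      using old by (auto simp: cell_value_def)
    thus ?thesis unfolding read_slot_def using True assms
      by (intro det_intros) (auto simp: env_def mem_def searching_def ans')
  next
    case False
    note st' = stores_allocate[OF st False N]
    have new: "cell_value (vars e vB) ((arrays e aBase)(?v := vars e vNxt)) (arrays e aOv) (word_of head) ?v ?i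
        = word_of \<tau> ?v ?i"
      using st' i unfolding stores_def by blast
    have B: "vars e vB \<le> vars e vNxt" using st by (simp add: stores_def)
    have "arrays e aOv (vars e vNxt + ?i) \<noteq> 0 \<Longrightarrow> arrays e aOv (vars e vNxt + ?i) = word_of \<tau> ?v ?i"
       "arrays e aOv (vars e vNxt + ?i) = 0 \<Longrightarrow> word_of head ?v ?i = word_of \<tau> ?v ?i"
      using new B by (auto simp: cell_value_def)
    thus ?thesis unfolding read_slot_def using False assms st' B
      by (intro det_intros) (auto simp: env_def mem_def searching_def ans' split: prod.splits)
  qed
qed

lemma scan_slot:
  assumes "env j f x e" "mem \<tau> e" "searching \<tau> e" "vars e vH < vars e vCnt" "vars e vT < N"
    and B: "vars e vB \<le> arrays e aBase (arrays e aQ (vars e vH))"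
    and i: "vars e vI < deg (arrays e aQ (vars e vH))"
    and w: "vars e vX = Suc (\<tau> (arrays e aQ (vars e vH)) (vars e vI))"
    and V: "\<And>v i. v \<in> V \<Longrightarrow> i < deg v \<Longrightarrow> \<tau> v i \<in> V"
  shows "det ans scan_slot e (\<lambda>e'. env j f x e' \<and> mem \<tau> e' \<and> searching \<tau> e' \<and>
    vars e' vH = vars e vH \<and> vars e' vT = Suc (vars e vT) \<and> run_time e' \<le> run_time e + 11)"
proof -
  let ?Q = "arrays e aQ" and ?n = "vars e vCnt" and ?h = "vars e vH" and ?i = "vars e vI"
  let ?w = "\<tau> (?Q ?h) ?i"
  have S: "search \<tau> ?Q ?n (arrays e aPq) (arrays e aPs) (arrays e aSq) (arrays e aSs) ?h ?i (vars e vT)"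
    and pos: "\<And>j. j < ?n \<Longrightarrow> arrays e aPos (?Q j) = j"
    and sc: "\<And>j l. (j, l) \<in> scanned ?Q ?h ?i \<Longrightarrow> l < N \<and> vars e vB \<le> arrays e aBase (?Q j)"
    using assms(3) unfolding searching_def by auto
  have iN: "?i < N" using S assms(5) by (auto simp: search_def)
  have "?Q ?h \<in> V" using S assms(4) by (auto simp: search_def)
  hence wV: "?w \<in> V" using V i by blast
  \<comment> \<open>A stale \<open>aPos\<close> entry cannot pass the test: it would have to point
    to an occurrence of the vertex in the queue.\<close>
  have visited: "arrays e aPos ?w < ?n \<and> ?Q (arrays e aPos ?w) = ?w \<longleftrightarrow> ?w \<in> ?Q ` {..<?n}"
    using pos by (auto simp: image_iff intro!: bexI[of _ "arrays e aPos ?w"])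
  \<comment> \<open>\<open>P\<close> omits the running time, so it can be derived from the other
    fields of the final state alone.\<close>
  define P where "P = (\<lambda>e'. env j f x e' \<and> mem \<tau> e' \<and> searching \<tau> e' \<and>
    vars e' vH = vars e vH \<and> vars e' vT = Suc (vars e vT))"
  have goal: "(\<lambda>e'. env j f x e' \<and> mem \<tau> e' \<and> searching \<tau> e' \<and>
    vars e' vH = vars e vH \<and> vars e' vT = Suc (vars e vT) \<and> run_time e' \<le> run_time e + 11) =
    (\<lambda>e'. P e' \<and> run_time e' \<le> run_time e + 11)"
    by (auto simp: P_def)
  show ?thesis
  proof (cases "?w \<in> ?Q ` {..<?n}")
    case True
    note S' = search_scan[OF S assms(4) i True]
    have sc': "\<forall>(j, l) \<in> scanned ?Q ?h (Suc ?i). l < N \<and> vars e vB \<le> arrays e aBase (?Q j)"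
      using sc B iN by (auto simp: scanned_Suc)
    have post: "P e'"
      if "vars e' = (vars e)(vX := ?w, vT := Suc (vars e vT), vI := Suc ?i)"
        "arrays e' = (arrays e)(aSq := (arrays e aSq)(vars e vT := ?h), aSs := (arrays e aSs)(vars e vT := ?i))"
        "rvars e' = rvars e" for e'
      using assms(1,2,5) S' sc' pos by (simp add: that P_def env_def mem_def searching_def)
    show ?thesis
      unfolding goal scan_slot_def
      apply (intro det_intros)
      subgoal using w by (intro conjI post) simp_all
      subgoal using visited True w by simp
      done
  next
    case False
    note S' = search_discover[OF S assms(4) i refl False wV]
    have lt: "j < ?n" if "(j, l) \<in> scanned ?Q ?h ?i" for j l using scanned_in_slots[OF S that] by simp
    have "scanned (?Q(?n := ?w)) ?h (Suc ?i) = insert (?h, ?i) (scanned ?Q ?h ?i)"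
      unfolding scanned_Suc[symmetric] using assms(4) by (auto simp: scanned_def)
    with sc lt B iN assms(4) have sc': "\<forall>(j, l) \<in> scanned (?Q(?n := ?w)) ?h (Suc ?i).
        l < N \<and> vars e vB \<le> arrays e aBase ((?Q(?n := ?w)) j)" by fastforce
    have pos': "\<forall>j < Suc ?n. ((arrays e aPos)(?w := ?n)) ((?Q(?n := ?w)) j) = j"
    proof -
      have "?Q j \<noteq> ?w" if "j < ?n" for j using False that by (metis imageI lessThan_iff)
      with pos show ?thesis by (simp add: less_Suc_eq)
    qed
    have post: "P e'"
      if "vars e' = (vars e)(vX := ?w, vCnt := Suc ?n, vT := Suc (vars e vT), vI := Suc ?i)"
        "arrays e' = (arrays e)(aSq := (arrays e aSq)(vars e vT := ?h), aSs := (arrays e aSs)(vars e vT := ?i),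
           aQ := ?Q(?n := ?w), aPos := (arrays e aPos)(?w := ?n),
           aPq := (arrays e aPq)(?n := ?h), aPs := (arrays e aPs)(?n := ?i))"
        "rvars e' = rvars e" for e'
      using assms(1,2,5) S' sc' pos'
      by (simp add: that P_def env_def mem_def searching_def del: fun_upd_apply add: fun_upd_same fun_upd_other)
    show ?thesis
      unfolding goal scan_slot_def
      apply (intro det_intros)
      subgoal using visited False w by simp
      subgoal using w by (intro conjI post) simp_all
      done
  qed
qed

lemma elapse_invariants [simp]:
  "env j f x (elapse d e) = env j f x e" "mem \<tau> (elapse d e) = mem \<tau> e"
  "searching \<tau> (elapse d e) = searching \<tau> e"
  by (simp_all add: env_def mem_def searching_def)

lemma searching_bounds:
  assumes "searching \<tau> e"
  shows "vars e vT \<le> N" "vars e vH \<le> vars e vCnt" "vars e vCnt \<le> vars e vT + 1"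
  using assms by (simp_all add: searching_def search_def)

text \<open>A step either scans a slot or moves on to the next queued vertex, so the sum of
  \<open>vH\<close> and \<open>vT\<close> serves as the loop measure.\<close>

lemma search_step:
  assumes "env j f x e" "mem \<tau> e" "searching \<tau> e" "vars e vH < vars e vCnt" "vars e vT < N"
    and V: "\<And>v i. v \<in> V \<Longrightarrow> i < deg v \<Longrightarrow> \<tau> v i \<in> V"
  shows "det ans search_step e (\<lambda>e'. env j f x e' \<and> mem \<tau> e' \<and> searching \<tau> e' \<and>
    vars e' vH + vars e' vT = Suc (vars e vH + vars e vT) \<and> run_time e' \<le> run_time e + 24)"
  unfolding search_step_def
proof (rule det_Seq, rule det_conseq[OF read_slot[OF assms(1-5)]], elim conjE, rule det_IfElse, goal_cases)
  case (1 e')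
  hence "vars e vI < deg (arrays e aQ (vars e vH))"
    by (auto simp: word_of_def split: if_splits)
  hence "det ans scan_slot (elapse 1 e') (\<lambda>e''. env j f x e'' \<and> mem \<tau> e'' \<and> searching \<tau> e'' \<and>
      vars e'' vH = vars e' vH \<and> vars e'' vT = Suc (vars e' vT) \<and> run_time e'' \<le> run_time (elapse 1 e') + 11)"
    using scan_slot[of j f x "elapse 1 e'" \<tau>] 1 assms(4,5) V
    by (simp add: env_def mem_def searching_def word_of_def)
  thus ?case by (rule det_conseq) (use 1 in auto)
next
  case (2 e')
  hence "\<not> vars e vI < deg (arrays e aQ (vars e vH))"
    by (auto simp: word_of_def split: if_splits)
  hence S': "search \<tau> (arrays e' aQ) (vars e' vCnt) (arrays e' aPq) (arrays e' aPs) (arrays e' aSq)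
      (arrays e' aSs) (Suc (vars e' vH)) 0 (vars e' vT)"
    using 2 assms(4) by (intro search_next_vertex[where i = "vars e' vI"]) (auto simp: searching_def)
  have i: "vars e' vI = deg (arrays e' aQ (vars e' vH))"
    using 2 \<open>\<not> vars e vI < _\<close> assms(4) by (auto simp: searching_def search_def)
  have "scanned (arrays e' aQ) (Suc (vars e' vH)) 0 = scanned (arrays e' aQ) (vars e' vH) (vars e' vI)"
    unfolding i by (auto simp: scanned_def less_Suc_eq)
  with S' show ?case
    by (intro det_intros) (use 2 in \<open>auto simp: env_def mem_def searching_def\<close>)
qed

lemma search_code:
  assumes "env j f x e" "mem \<tau> e" and V: "\<And>v i. v \<in> V \<Longrightarrow> i < deg v \<Longrightarrow> \<tau> v i \<in> V"
  shows "det ans search_code e (\<lambda>e'. env j f x e' \<and> mem \<tau> e' \<and> searching \<tau> e' \<and>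
    (vars e' vT < N \<longrightarrow> vars e' vH = vars e' vCnt) \<and> run_time e' \<le> run_time e + 50 * N + 32)"
  unfolding search_code_def
proof -
  \<comment> \<open>From \<open>vH \<le> vCnt \<le> vT + 1\<close> and \<open>vT \<le> N\<close> the
    sum \<open>vH + vT\<close> is at most \<open>2 * N + 1\<close>. Each iteration costs 24 plus one
    for the test.\<close>
  let ?I = "\<lambda>n e'. env j f x e' \<and> mem \<tau> e' \<and> searching \<tau> e' \<and> n + vars e' vH + vars e' vT = 2 * N + 1 \<and>
     run_time e' + 25 * n \<le> run_time e + 50 * N + 31"
  let ?Q = "\<lambda>e'. env j f x e' \<and> mem \<tau> e' \<and> searching \<tau> e' \<and>
    (vars e' vT < N \<longrightarrow> vars e' vH = vars e' vCnt) \<and> run_time e' \<le> run_time e + 50 * N + 32"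
  let ?b = "Conj (Neg (Le (Var vCnt) (Var vH))) (Neg (Le (Var vN) (Var vT)))"
  have loop: "?I n e' \<Longrightarrow> det ans (While ?b search_step) e' ?Q" for n e'
  proof (rule det_While[where I = ?I], assumption, goal_cases)
    case (1 n e1)
    hence lt: "vars e1 vH < vars e1 vCnt" "vars e1 vT < N" by (auto simp: env_def)
    have "det ans search_step (elapse 1 e1) (\<lambda>e'. env j f x e' \<and> mem \<tau> e' \<and> searching \<tau> e' \<and>
      vars e' vH + vars e' vT = Suc (vars (elapse 1 e1) vH + vars (elapse 1 e1) vT) \<and>
      run_time e' \<le> run_time (elapse 1 e1) + 24)"
      by (rule search_step) (use 1 lt V in auto)
    thus ?case
    proof (rule det_conseq)
      fix e2 assume e2: "env j f x e2 \<and> mem \<tau> e2 \<and> searching \<tau> e2 \<and>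
        vars e2 vH + vars e2 vT = Suc (vars (elapse 1 e1) vH + vars (elapse 1 e1) vT) \<and>
        run_time e2 \<le> run_time (elapse 1 e1) + 24"
      hence "vars e2 vH + vars e2 vT \<le> 2 * N + 1" using searching_bounds[of \<tau> e2] by linarith
      with e2 1 show "\<exists>m<n. ?I m e2" by (intro exI[of _ "n - 1"]) auto
    qed
  next
    case (2 n e1)
    hence "vars e1 vT < N \<longrightarrow> vars e1 vH = vars e1 vCnt"
      using searching_bounds(2)[of \<tau> e1] by (simp add: env_def) linarith
    thus ?case using 2 by simp
  qed
  have init: "?I (2 * N + 1) e'"
    if "vars e' = (vars e)(vCnt := 1, vH := 0, vI := 0, vT := 0)"
      "arrays e' = (arrays e)(aQ := (arrays e aQ)(0 := s), aPos := (arrays e aPos)(s := 0))"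
      "rvars e' = rvars e" "run_time e' = run_time e + 6" for e'
    using assms(1,2) search_init by (simp add: that env_def mem_def searching_def scanned_def)
  show "det ans (Store aQ (Const 0) (Var vS) ;; Store aPos (Var vS) (Const 0) ;; Assign vCnt (Const 1) ;;
     Assign vH (Const 0) ;; Assign vI (Const 0) ;; Assign vT (Const 0) ;; While ?b search_step) e ?Q"
    apply (intro det_Seq det_Assign det_Store)
    apply (rule loop)
    apply (rule init)
    subgoal by simp
    subgoal using assms(1) by (simp add: env_def)
    subgoal by simp
    subgoal by simp
    done
qed

text \<open>The drawn slot is blanked, and the blank moves up the tree while the sum in
  \<open>leaving_except_step\<close> stays fixed. Comparing both ends of the path, the number of
  edges leaving \<open>X\<close> drops by one unless both ends of the drawn edge lie in
  \<open>X\<close>.\<close>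

lemma reverse_code:
  assumes env: "env j f x e" and mem: "mem \<tau> e" and srch: "searching \<tau> e" and R: "residual \<tau> i"
    and r: "vars e vR < vars e vT"
  shows "det ans reverse_code e (\<lambda>e'. env j f x e' \<and> run_time e' \<le> run_time e + 4 * N + 4 \<and>
    (\<exists>\<tau>'. mem \<tau>' e' \<and> residual \<tau>' (Suc i) \<and>
      (\<forall>C. s \<in> C \<longrightarrow> C \<subseteq> V \<longrightarrow> arrays e aQ (arrays e aSq (vars e vR)) \<notin> C \<longrightarrow>
        leaving \<tau> C = Suc (leaving \<tau>' C))))"
proof -
  define Q pq ps n h l0 t where
    "Q = arrays e aQ" and "pq = arrays e aPq" and "ps = arrays e aPs" and
    "n = vars e vCnt" and "h = vars e vH" and "l0 = vars e vI" and "t = vars e vT"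
  define r where "r = vars e vR"
  define u l where "u = arrays e aSq r" and "l = arrays e aSs r"
  define w where "w = \<tau> (Q u) l"
  have S: "search \<tau> Q n pq ps (arrays e aSq) (arrays e aSs) h l0 t"
    and sc: "\<And>j l. (j, l) \<in> scanned Q h l0 \<Longrightarrow> l < N \<and> vars e vB \<le> arrays e aBase (Q j)"
    and tN: "t \<le> N"
    using srch unfolding searching_def Q_def pq_def ps_def n_def h_def l0_def t_def by auto
  have ul: "(u, l) \<in> scanned Q h l0"
    using card_scanned(2)[OF S, of r] r unfolding u_def l_def r_def t_def by simp
  have inj: "inj_on Q {..<n}" and Q0: "Q 0 = s" "0 < n" and QV: "Q ` {..<n} \<subseteq> V" and nt: "n \<le> t + 1"
    and tree: "\<And>j. 0 < j \<Longrightarrow> j < n \<Longrightarrow> pq j < j \<and> (pq j, ps j) \<in> scanned Q h l0 \<and> \<tau> (Q (pq j)) (ps j) = Q j"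
    using S unfolding search_def by auto
  \<comment> \<open>\<open>\<sigma>\<close> holds the current heads. Slot \<open>vL\<close> of
    \<open>Q m\<close> counts as blank, and the tree edges up to position \<open>m\<close> are
    intact. Note that \<open>u\<close> is a queue position while \<open>w\<close> is a vertex. The
    time clause starts from \<open>m \<le> N\<close>, which follows from
    \<open>n \<le> t + 1\<close>.\<close>
  define I where "I = (\<lambda>m e'. \<exists>\<sigma>. env j f x e' \<and> mem \<sigma> e' \<and> m = vars e' vR \<and> vars e' vR < n \<and>
     vars e' vB = vars e vB \<and>
     arrays e' aBase = arrays e aBase \<and> arrays e' aQ = Q \<and> arrays e' aPq = pq \<and> arrays e' aPs = ps \<and>
     (m, vars e' vL) \<in> scanned Q h l0 \<and>
     (\<forall>j. 0 < j \<longrightarrow> j \<le> m \<longrightarrow> \<sigma> (Q (pq j)) (ps j) = Q j) \<and>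
     (\<forall>v\<in>V. \<forall>i<deg v. \<sigma> v i \<in> V) \<and>
     (\<forall>X. s \<in> X \<longrightarrow> X \<subseteq> V \<longrightarrow> leaving_except \<sigma> (Q m) (vars e' vL) X + of_bool (Q m \<in> X) =
        leaving \<tau> X + of_bool (Q u \<in> X \<and> w \<in> X)) \<and>
     run_time e' + 4 * m \<le> run_time e + 4 * N + 2)"
  note slot = scanned_in_slots[OF S]
  let ?post = "\<lambda>e'. env j f x e' \<and> run_time e' \<le> run_time e + 4 * N + 4 \<and>
    (\<exists>\<tau>'. mem \<tau>' e' \<and> residual \<tau>' (Suc i) \<and>
      (\<forall>C. s \<in> C \<longrightarrow> C \<subseteq> V \<longrightarrow> Q u \<notin> C \<longrightarrow> leaving \<tau> C = Suc (leaving \<tau>' C)))"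
  have override: "mem (redirect \<sigma> (Q m) l' y) 
      (elapse d (set_elem aOv (arrays e' aBase (Q m) + l') (Suc y) e'))"
    if "mem \<sigma> e'" "(m, l') \<in> scanned Q h l0" "vars e' vB = vars e vB" "arrays e' aBase = arrays e aBase"
    for \<sigma> m l' y e' d
  proof -
    have "stores N (vars e' vB) (vars e' vNxt) (arrays e' aBase)
        ((arrays e' aOv)(arrays e' aBase (Q m) + l' := Suc y)) (word_of head)
        ((word_of \<sigma>)(Q m := (word_of \<sigma> (Q m))(l' := Suc y)))"
      by (rule stores_override) (use that(1,3,4) sc[OF that(2)] in \<open>simp_all add: mem_def\<close>)
    thus ?thesis unfolding mem_def word_of_redirect[OF slot(2)[OF that(2)]] by simp
  qed
  have init: "I u (elapse 1 (set_var vR (aval (Elem aSq (Var vR)) (elapse 1 (set_var vL (aval (Elem aSs (Var vR)) e) e)))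
       (elapse 1 (set_var vL (aval (Elem aSs (Var vR)) e) e))))"
    unfolding I_def
  proof (rule exI[of _ \<tau>], intro conjI allI impI ballI)
    fix X assume X: "s \<in> X" "X \<subseteq> V"
    show "leaving_except \<tau> (Q u) (vars (elapse 1 (set_var vR (aval (Elem aSq (Var vR))
        (elapse 1 (set_var vL (aval (Elem aSs (Var vR)) e) e))) (elapse 1 (set_var vL (aval (Elem aSs (Var vR)) e) e)))) vL) X +
        of_bool (Q u \<in> X) = leaving \<tau> X + of_bool (Q u \<in> X \<and> w \<in> X)"
      using leaving_eq_leaving_except[OF X(2) slot(2)[OF ul], of \<tau>]
      by (auto simp: w_def l_def u_def r_def split: if_splits)
  qed (use env mem ul slot(1)[OF ul] tree nt tN R in
      \<open>auto simp: env_def mem_def u_def l_def r_def Q_def pq_def ps_def residual_def\<close>)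
  have step: "det ans (Store aOv (Plus (Elem aBase (Elem aQ (Var vR))) (Var vL))
          (Plus (Elem aQ (Elem aPq (Var vR))) (Const 1)) ;;
        Assign vL (Elem aPs (Var vR)) ;;
        Assign vR (Elem aPq (Var vR))) (elapse 1 e1) (\<lambda>e'. \<exists>m'<m. I m' e')"
    if Im: "I m e1" and pos: "0 < m" for m e1
  proof -
    from Im obtain \<sigma> where \<sigma>: "env j f x e1" "mem \<sigma> e1" "m = vars e1 vR" "m < n"
       "vars e1 vB = vars e vB"
     "arrays e1 aBase = arrays e aBase" "arrays e1 aQ = Q" "arrays e1 aPq = pq" "arrays e1 aPs = ps"
     "(m, vars e1 vL) \<in> scanned Q h l0"
     "\<And>j. 0 < j \<Longrightarrow> j \<le> m \<Longrightarrow> \<sigma> (Q (pq j)) (ps j) = Q j"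
     "\<And>v i. v \<in> V \<Longrightarrow> i < deg v \<Longrightarrow> \<sigma> v i \<in> V"
     "\<And>X. s \<in> X \<Longrightarrow> X \<subseteq> V \<Longrightarrow> leaving_except \<sigma> (Q m) (vars e1 vL) X + of_bool (Q m \<in> X) =
        leaving \<tau> X + of_bool (Q u \<in> X \<and> w \<in> X)"
     "run_time e1 + 4 * m \<le> run_time e + 4 * N + 2"
      unfolding I_def by auto
    note t = tree[OF pos \<sigma>(4)]
    let ?\<sigma> = "redirect \<sigma> (Q m) (vars e1 vL) (Q (pq m))"
    \<comment> \<open>The remaining tree edges start at positions before \<open>m\<close>, hence at
      vertices other than \<open>Q m\<close>, and are not overwritten.\<close>
    have ne: "Q a \<noteq> Q m" if "a < m" for a using inj that \<sigma>(4) by (auto dest: inj_onD)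
    have tree': "?\<sigma> (Q (pq j)) (ps j) = Q j" if "0 < j" "j \<le> pq m" for j
      using \<sigma>(11)[of j] tree[of j] ne[of "pq j"] that t \<sigma>(4) by (auto simp: redirect_apply)
    have QmV: "Q (pq m) \<in> V" using slot(3) t by blast
    have V': "?\<sigma> v i \<in> V" if "v \<in> V" "i < deg v" for v i
      using \<sigma>(12)[OF that] QmV by (simp add: redirect_apply)
    have leave': "leaving_except ?\<sigma> (Q (pq m)) (ps m) X + of_bool (Q (pq m) \<in> X) =
        leaving \<tau> X + of_bool (Q u \<in> X \<and> w \<in> X)" if "s \<in> X" "X \<subseteq> V" for X
      unfolding \<sigma>(13)[OF that, symmetric]
      by (rule leaving_except_step[OF that(2)]) (use slot(2)[OF \<sigma>(10)] slot(2) t ne \<sigma>(11) pos in auto)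
    have mem': "mem ?\<sigma> (elapse 1 (set_elem aOv (arrays e1 aBase (Q m) + vars e1 vL) (Suc (Q (pq m))) (elapse 1 e1)))"
      using override[of \<sigma> "elapse 1 e1" m "vars e1 vL" "Q (pq m)" 1] \<sigma>(2,5,6,10) by (simp add: mem_def)
    have "I (pq m) e2" if "vars e2 = (vars e1)(vL := ps m, vR := pq m)" "rvars e2 = rvars e1"
       "arrays e2 = (arrays e1)(aOv := (arrays e1 aOv)(arrays e1 aBase (Q m) + vars e1 vL := Suc (Q (pq m))))"
       "run_time e2 = run_time e1 + 4" for e2
      unfolding I_def
      by (rule exI[of _ ?\<sigma>])
         (use that \<sigma>(1,3-10,14) mem' tree' V' leave' t in \<open>auto simp: env_def mem_def\<close>)
    with t show ?thesis
      by (intro det_intros exI[of _ "pq m"]) (use \<sigma>(3,7-9) in simp)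
  qed
  have fin: "det ans (Store aOv (Plus (Elem aBase (Elem aQ (Var vR))) (Var vL)) (Plus (Var vS) (Const 1)))
       (elapse 1 e1) ?post" if "I 0 e1" for e1
  proof (rule det_Store)
    from that obtain \<sigma> where \<sigma>: "env j f x e1" "mem \<sigma> e1" "0 = vars e1 vR"
       "vars e1 vB = vars e vB"
     "arrays e1 aBase = arrays e aBase" "arrays e1 aQ = Q" 
     "(0, vars e1 vL) \<in> scanned Q h l0"
     "\<And>v i. v \<in> V \<Longrightarrow> i < deg v \<Longrightarrow> \<sigma> v i \<in> V"
     "\<And>X. s \<in> X \<Longrightarrow> X \<subseteq> V \<Longrightarrow> leaving_except \<sigma> (Q 0) (vars e1 vL) X + of_bool (Q 0 \<in> X) =
        leaving \<tau> X + of_bool (Q u \<in> X \<and> w \<in> X)"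
     "run_time e1 \<le> run_time e + 4 * N + 2"
      unfolding I_def by auto
    let ?\<sigma> = "redirect \<sigma> s (vars e1 vL) s"
    \<comment> \<open>The loop at \<open>s\<close> never leaves \<open>X\<close>, so filling the
      last blank adds nothing to the count.\<close>
    have leave: "leaving \<tau> X = leaving ?\<sigma> X + of_bool (Q u \<notin> X \<or> w \<notin> X)" if X: "s \<in> X" "X \<subseteq> V" for X
      using \<sigma>(9)[OF X] leaving_redirect[OF X(2), of "vars e1 vL" s \<sigma> s] slot(2)[OF \<sigma>(7)] X
      by (auto simp: Q0 split: if_splits)
    have "residual ?\<sigma> (Suc i)"
      by (rule residual_Suc[OF R _ leave]) (use \<sigma>(8) s_in_V in \<open>auto simp: redirect_apply\<close>)
    moreover have "mem ?\<sigma> (elapse 1 (set_elem aOv (arrays e1 aBase s + vars e1 vL) (Suc s) (elapse 1 e1)))"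
      using override[of \<sigma> "elapse 1 e1" 0 "vars e1 vL" s 1] \<sigma>(2,4,5,7) by (simp add: mem_def Q0)
    ultimately show "?post (elapse 1 (set_elem aOv (aval (Plus (Elem aBase (Elem aQ (Var vR))) (Var vL)) (elapse 1 e1))
       (aval (Plus (Var vS) (Const 1)) (elapse 1 e1)) (elapse 1 e1)))"
      using leave \<sigma>(1,3,6,10) by (auto simp: env_def Q0)
  qed
  have idx: "I m e1 \<Longrightarrow> m = vars e1 vR" for m e1 unfolding I_def by blast
  show ?thesis
    unfolding reverse_code_def u_def[symmetric] r_def[symmetric] Q_def[symmetric]
    apply (rule det_Seq det_Assign)+
    apply (rule det_While[where I = I, OF init])
    subgoal for m e1
      using idx[of m e1] by (intro step) simp_all
    subgoal for m e1
      using idx[of m e1] by (intro fin) (cases "m = 0"; simp)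
    done
qed

section \<open>Rounds, attempts and the main loop\<close>

text \<open>The slots of \<open>U\<close> comprise its inner and its leaving edges, so their number
  also bounds the edge size.\<close>

definition found :: "state \<Rightarrow> bool" where
  "found e \<longleftrightarrow> (let U = arrays e aQ ` {..<vars e vCnt} in
     s \<in> U \<and> U \<subseteq> V \<and> leaving head U \<le> k \<and> card (slots U) < N \<and>
     (\<forall>X. s \<in> X \<longrightarrow> X \<subset> U \<longrightarrow> leaving head U < leaving head X))"

text \<open>The bound \<open>\<Delta> + k\<close> adds up at most \<open>\<Delta>\<close> inner and
  at most \<open>k\<close> leaving edges.\<close>

definition good :: "nat set \<Rightarrow> bool" where
  "good C \<longleftrightarrow> s \<in> C \<and> C \<subseteq> V \<and> leaving head C \<le> k \<and> card (slots C) \<le> \<Delta> + k"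

definition \<delta> :: real where "\<delta> = real (\<Delta> + k) / real N"

text \<open>This potential bounds the probability that the current trial still fails. In the middle
  case at most \<open>k - vJ\<close> draws remain, each starting in \<open>C\<close> with
  probability at most \<open>\<delta>\<close>; at \<open>vJ = k\<close> the next search must get
  stuck, so the risk is 0. \<open>\<tau>\<close> is existential because \<open>mem\<close> fixes it
  only on slots below \<open>N\<close>.\<close>

definition round_risk :: "nat set \<Rightarrow> state \<Rightarrow> ennreal" where
  "round_risk C e = (if vars e vF = 1 then 0
     else if good C \<and> vars e vJ \<le> k \<and>
       (\<exists>\<tau>. mem \<tau> e \<and> residual \<tau> (vars e vJ) \<and> leaving \<tau> C + vars e vJ \<le> k)
     then ennreal (real (k - vars e vJ) * \<delta>) else 1)"

text \<open>The factor \<open>2 * (k + 1)\<close> in \<open>N\<close> is chosen so that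
  \<open>k\<close> draws of risk \<open>\<delta>\<close> cost at most one half.\<close>

lemma \<delta>: "0 \<le> \<delta>" "real (k - j) * \<delta> \<le> 1 / 2" "real N * \<delta> = real (\<Delta> + k)"
proof -
  have N: "real N = 2 * (real k + 1) * real (\<Delta> + k)" "0 < real N"
    using N_ge_2 by (subst N_eq, simp add: algebra_simps, simp)
  show "0 \<le> \<delta>" by (simp add: \<delta>_def)
  show "real N * \<delta> = real (\<Delta> + k)" using N(2) by (simp add: \<delta>_def)
  have "real (k - j) * real (\<Delta> + k) * 2 \<le> (real k + 1) * real (\<Delta> + k) * 2"
    by (intro mult_right_mono) auto
  thus "real (k - j) * \<delta> \<le> 1 / 2"
    using N by (simp add: \<delta>_def field_simps)
qed

lemma round_risk_le_1: "round_risk C e \<le> 1"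
  using \<delta>(2)[of "vars e vJ"] by (auto simp: round_risk_def)

lemma N_gt: "\<Delta> + k < N"
  using \<Delta>_pos by (simp add: N_eq algebra_simps)

text \<open>At most \<open>\<Delta> + k\<close> of the \<open>N\<close> indices start in
  \<open>C\<close>. They contribute \<open>\<delta>\<close> to the average, and the remaining risk
  contributes at most \<open>k - Suc j\<close> further multiples.\<close>

lemma random_slot_risk:
  assumes S: "searching \<tau> e" and t: "N \<le> vars e vT" and C: "good C" "leaving \<tau> C + j \<le> k"
  shows "(\<Sum>n\<le>N - 1. if arrays e aQ (arrays e aSq n) \<in> C then 1 else ennreal (real (k - Suc j) * \<delta>)) /
     of_nat N \<le> ennreal (real (k - j) * \<delta>)"
proof -
  let ?bad = "\<lambda>n. arrays e aQ (arrays e aSq n) \<in> C"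
  have S': "search \<tau> (arrays e aQ) (vars e vCnt) (arrays e aPq) (arrays e aPs) (arrays e aSq) (arrays e aSs)
     (vars e vH) (vars e vI) (vars e vT)" and tN: "vars e vT = N"
    using S t by (auto simp: searching_def)
  have C': "s \<in> C" "C \<subseteq> V" "card (slots C) \<le> \<Delta> + k" using C by (auto simp: good_def)
  \<comment> \<open>If \<open>j = k\<close>, no residual edge would leave \<open>C\<close>, and the
    search would stop after at most \<open>\<Delta> + k < N\<close> slots. So the truncated
    difference \<open>k - j\<close> is positive.\<close>
  have "j \<noteq> k"
  proof
    assume "j = k"
    with C have "leaving \<tau> C = 0" by simp
    from search_confined[OF S' C'(2,1) this] C'(3) N_gt tN show False by simp
  qed
  with C(2) have j: "real (k - j) = 1 + real (k - Suc j)" by (auto simp: of_nat_diff)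
  have N0: "0 < real N" using N_ge_2 by simp
  have set: "{..N - 1} = {..<N}" using N_ge_2 by auto
  have card: "real (card {n. n < N \<and> ?bad n}) \<le> real (\<Delta> + k)"
    using card_scanned_from[OF S' C'(2)] C'(3) tN by simp
  let ?g = "\<lambda>n. if ?bad n then 1 else real (k - Suc j) * \<delta>"
  have g: "(if ?bad n then 1 else ennreal (real (k - Suc j) * \<delta>)) = ennreal (?g n)" for n by simp
  have "(\<Sum>n<N. ?g n) \<le> (\<Sum>n<N. of_bool (?bad n) + real (k - Suc j) * \<delta>)"
    using \<delta>(1) by (intro sum_mono) auto
  also have "\<dots> = real (card {n. n < N \<and> ?bad n}) + real N * (real (k - Suc j) * \<delta>)"
    by (simp add: sum.distrib Collect_conj_eq lessThan_def)
  also have "\<dots> \<le> real N * \<delta> + real N * (real (k - Suc j) * \<delta>)"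
    using card \<delta>(3) by simp
  also have "\<dots> = real N * (real (k - j) * \<delta>)" by (simp add: j algebra_simps)
  finally have "(\<Sum>n<N. ?g n) / real N \<le> real (k - j) * \<delta>"
    using N0 by (simp add: divide_le_eq mult.commute)
  moreover have "(\<Sum>n\<le>N - 1. if ?bad n then 1 else ennreal (real (k - Suc j) * \<delta>)) / of_nat N =
     ennreal ((\<Sum>n<N. ?g n) / real N)"
  proof -
    have pos: "0 \<le> ?g n" for n using \<delta>(1) by simp
    hence "(\<Sum>n<N. ennreal (?g n)) = ennreal (\<Sum>n<N. ?g n)" by (intro sum_ennreal)
    moreover have "ennreal (\<Sum>n<N. ?g n) / ennreal (real N) = ennreal ((\<Sum>n<N. ?g n) / real N)"
      by (intro divide_ennreal sum_nonneg pos N0)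
    ultimately show ?thesis unfolding g set by (simp add: ennreal_of_nat_eq_real_of_nat)
  qed
  ultimately show ?thesis by (simp add: ennreal_leI)
qed

lemma round_code:
  assumes env: "env j 0 x e" and mem: "mem \<tau> e" and R: "residual \<tau> j" and j: "j \<le> k"
  shows "prob ans round_code e
    (\<lambda>e'. (env (Suc j) 0 x e' \<and> (\<exists>\<tau>'. mem \<tau>' e' \<and> residual \<tau>' (Suc j)) \<or> env (Suc j) 1 x e' \<and> found e') \<and>
       run_time e' \<le> run_time e + 54 * N + 45)
    (round_risk C)
    (if good C \<and> leaving \<tau> C + j \<le> k then ennreal (real (k - j) * \<delta>) else 1)"
proof -
  let ?u = "if good C \<and> leaving \<tau> C + j \<le> k then ennreal (real (k - j) * \<delta>) else 1"
  let ?upd = "\<lambda>e. elapse 1 (set_var vJ (aval (Plus (Var vJ) (Const 1)) e) e)"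
  define Q where "Q = (\<lambda>e'. (env (Suc j) 0 x e' \<and> (\<exists>\<tau>'. mem \<tau>' e' \<and> residual \<tau>' (Suc j)) \<or>
       env (Suc j) 1 x e' \<and> found e') \<and>
       run_time e' \<le> run_time e + 54 * N + 45)"
  have V: "\<tau> v i \<in> V" if "v \<in> V" "i < deg v" for v i using R that by (simp add: residual_def)
  have last: "prob ans (Assign vJ (Plus (Var vJ) (Const 1))) e' Q (round_risk C) (round_risk C (?upd e'))"
    if "Q (?upd e')" for e'
    using that by (intro prob_det det_Assign) simp
  have main: "prob ans (IfElse (Le (Var vN) (Var vT))
       (Random vR (Minus (Var vN) (Const 1)) ;; reverse_code)
       (Assign vF (Const 1))) e1 (\<lambda>e'. Q (?upd e')) (\<lambda>e'. round_risk C (?upd e')) ?u"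
    if e1: "env j 0 x e1" "mem \<tau> e1" "searching \<tau> e1" "vars e1 vT < N \<longrightarrow> vars e1 vH = vars e1 vCnt"
      "run_time e1 \<le> run_time e + 50 * N + 32" for e1
  proof (rule prob_IfElse)
    assume "\<not> bval (Le (Var vN) (Var vT)) e1"
    hence t: "vars e1 vT < N" "vars e1 vH = vars e1 vCnt" using e1 by (auto simp: env_def)
    have S: "search \<tau> (arrays e1 aQ) (vars e1 vCnt) (arrays e1 aPq) (arrays e1 aPs) (arrays e1 aSq)
        (arrays e1 aSs) (vars e1 vCnt) (vars e1 vI) (vars e1 vT)"
      using e1(3) t(2) by (simp add: searching_def)
    note U = search_complete[OF S R]
    have "found e'" if "arrays e' = arrays e1" "vars e' vCnt = vars e1 vCnt" for e'
      unfolding found_def Let_def using U t j by (auto simp: that)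
    hence "Q (?upd (elapse 1 (set_var vF 1 (elapse 1 e1))))"
      using e1(1,5) by (auto simp: Q_def env_def)
    thus "prob ans (Assign vF (Const 1)) (elapse 1 e1) (\<lambda>e'. Q (?upd e')) (\<lambda>e'. round_risk C (?upd e')) ?u"
      by (intro prob_det det_Assign) (simp add: round_risk_def)
  next
    assume "bval (Le (Var vN) (Var vT)) e1"
    hence t: "N \<le> vars e1 vT" using e1 by (simp add: env_def)
    let ?bad = "\<lambda>n. arrays e1 aQ (arrays e1 aSq n) \<in> C"
    \<comment> \<open>The potential between draw and reversal: a draw inside \<open>C\<close> is
      counted as a failure, any other is known to remove an edge leaving \<open>C\<close>.\<close>
    let ?\<psi> = "\<lambda>e2. if good C \<and> leaving \<tau> C + j \<le> k then
        if ?bad (vars e2 vR) then 1 else ennreal (real (k - Suc j) * \<delta>) else 1"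
    show "prob ans (Random vR (Minus (Var vN) (Const 1)) ;; reverse_code) (elapse 1 e1)
       (\<lambda>e'. Q (?upd e')) (\<lambda>e'. round_risk C (?upd e')) ?u"
    proof (rule prob_Seq[where \<psi> = ?\<psi>], rule prob_Random)
      fix n assume "n \<le> aval (Minus (Var vN) (Const 1)) (elapse 1 e1)"
      hence n: "n < vars e1 vT" using e1(1) t N_ge_2 by (auto simp: env_def)
      let ?e2 = "elapse 1 (set_var vR n (elapse 1 e1))"
      have e2: "env j 0 x ?e2" "mem \<tau> ?e2" "searching \<tau> ?e2" "vars ?e2 vR < vars ?e2 vT"
        using e1(1-3) n by (simp_all add: env_def mem_def searching_def)
      show "prob ans reverse_code ?e2 (\<lambda>e'. Q (?upd e')) (\<lambda>e'. round_risk C (?upd e')) (?\<psi> ?e2)"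
      proof (rule prob_det, rule det_conseq[OF reverse_code[OF e2(1-3) R e2(4)]], elim conjE exE)
        fix e3 \<tau>' assume e3: "env j 0 x e3" "run_time e3 \<le> run_time ?e2 + 4 * N + 4" "mem \<tau>' e3"
          "residual \<tau>' (Suc j)"
          "\<forall>C. s \<in> C \<longrightarrow> C \<subseteq> V \<longrightarrow> arrays ?e2 aQ (arrays ?e2 aSq (vars ?e2 vR)) \<notin> C \<longrightarrow>
             leaving \<tau> C = Suc (leaving \<tau>' C)"
        have "Q (?upd e3)" unfolding Q_def using e3(1-4) e1(5) by (auto simp: env_def mem_def)
        moreover have "round_risk C (?upd e3) \<le> ?\<psi> ?e2"
        proof (cases "good C \<and> leaving \<tau> C + j \<le> k \<and> \<not> ?bad n")
          case True
          hence "leaving \<tau> C = Suc (leaving \<tau>' C)" using e3(5) by (simp add: good_def)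
          moreover have "mem \<tau>' (?upd e3)" using e3(3) by (simp add: mem_def)
          ultimately have "round_risk C (?upd e3) = ennreal (real (k - Suc j) * \<delta>)"
            using True e3(1,4) unfolding round_risk_def by (auto simp: env_def)
          thus ?thesis using True by simp
        next
          case False
          thus ?thesis using round_risk_le_1[of C "?upd e3"] by auto
        qed
        ultimately show "Q (?upd e3) \<and> round_risk C (?upd e3) \<le> ?\<psi> ?e2" ..
      qed
    next
      have N: "aval (Minus (Var vN) (Const 1)) (elapse 1 e1) = N - 1" "Suc (N - 1) = N"
        using e1(1) N_ge_2 by (auto simp: env_def)
      show "(\<Sum>n\<le>aval (Minus (Var vN) (Const 1)) (elapse 1 e1). ?\<psi> (elapse 1 (set_var vR n (elapse 1 e1)))) /
         of_nat (Suc (aval (Minus (Var vN) (Const 1)) (elapse 1 e1))) \<le> ?u"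
      proof (cases "good C \<and> leaving \<tau> C + j \<le> k")
        case True
        thus ?thesis using random_slot_risk[OF e1(3) t, of C j] unfolding N by simp
      next
        case False
        have "(of_nat N :: ennreal) / of_nat N = 1" using N_ge_2
          by (intro ennreal_divide_self) (auto simp: of_nat_less_top)
        thus ?thesis using False N by auto
      qed
    qed
  qed
  have "prob ans round_code e Q (round_risk C) ?u"
    unfolding round_code_def
  proof (rule prob_Seq_det, rule det_conseq, rule search_code[OF env mem], rule V, assumption, assumption,
      elim conjE, goal_cases)
    case (1 e1)
    show ?case
      by (rule prob_Seq[where \<psi> = "\<lambda>e'. round_risk C (?upd e')"], rule prob_conseq[OF main last])
        (use 1 in auto)
  qed
  thus ?thesis unfolding Q_def .
qed

definition ready :: "state \<Rightarrow> bool" where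
  "ready e \<longleftrightarrow> fresh (vars e vNxt) (arrays e aBase) (arrays e aOv)"

definition failure :: "state \<Rightarrow> ennreal" where
  "failure e = (if vars e vF = 1 then 0 else 1)"

lemma envD:
  assumes "env j f x e"
  shows "vars e vK = k" "vars e vS = s" "vars e vN = N" "vars e vJ = j" "vars e vF = f" "rvars e 0 = x"
  using assms by (simp_all add: env_def)

text \<open>\<open>round_risk\<close> is the loop potential. It starts at
  \<open>k * \<delta> \<le> 1 / 2\<close> for a good \<open>C\<close>; at an exit without success
  \<open>vJ\<close> exceeds \<open>k\<close>, so it is 1 and agrees with
  \<open>failure\<close>.\<close>

lemma attempt_code:
  assumes env: "env j 0 x e" and "ready e"
  shows "prob ans attempt_code e
    (\<lambda>e'. (\<exists>j. env j 0 x e' \<and> ready e' \<or> env j 1 x e' \<and> found e') \<and>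
       run_time e' \<le> run_time e + (k + 1) * (100 * N) + 3)
    failure (if good C then ennreal (1 / 2) else 1)"
proof -
  let ?I = "\<lambda>n e'. \<exists>j. (env j 0 x e' \<and> (\<exists>\<tau>. mem \<tau> e' \<and> residual \<tau> j) \<or> env j 1 x e' \<and> found e') \<and>
     n + j = k + 1 \<and> run_time e' + n * (100 * N) \<le> run_time e + (k + 1) * (100 * N) + 2"
  let ?b = "Conj (Le (Var vJ) (Var vK)) (Le (Var vF) (Const 0))"
  let ?Q = "\<lambda>e'. (\<exists>j. env j 0 x e' \<and> ready e' \<or> env j 1 x e' \<and> found e') \<and>
       run_time e' \<le> run_time e + (k + 1) * (100 * N) + 3"
  have loop: "?I n e' \<Longrightarrow> prob ans (While ?b round_code) e' ?Q failure (round_risk C e')" for n e'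
  proof (rule prob_While[where I = ?I], assumption, goal_cases)
    case (1 n e1)
    then obtain j where j: "env j 0 x e1 \<and> (\<exists>\<tau>. mem \<tau> e1 \<and> residual \<tau> j) \<or> env j 1 x e1 \<and> found e1"
      "n + j = k + 1" "run_time e1 + n * (100 * N) \<le> run_time e + (k + 1) * (100 * N) + 2" by blast
    have b: "vars e1 vJ \<le> vars e1 vK" "vars e1 vF = 0" using 1(3) by simp_all
    with j(1) have e1: "env j 0 x e1" "\<exists>\<tau>. mem \<tau> e1 \<and> residual \<tau> j" by (auto dest: envD(5))
    have jk: "j \<le> k" using b(1) envD[OF e1(1)] by simp
    \<comment> \<open>A \<open>\<tau>\<close> that witnesses a small risk is followed through the
      round if there is one; otherwise the risk is 1 and any \<open>\<tau>\<close> will do.\<close>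
    have "\<exists>\<tau>. mem \<tau> e1 \<and> residual \<tau> j \<and>
      (if good C \<and> leaving \<tau> C + j \<le> k then ennreal (real (k - j) * \<delta>) else 1) \<le> round_risk C e1"
    proof (cases "good C \<and> (\<exists>\<tau>. mem \<tau> e1 \<and> residual \<tau> j \<and> leaving \<tau> C + j \<le> k)")
      case True
      then obtain \<tau> where "mem \<tau> e1" "residual \<tau> j" "leaving \<tau> C + j \<le> k" by blast
      with True jk show ?thesis
        by (intro exI[of _ \<tau>]) (auto simp: round_risk_def envD[OF e1(1)])
    next
      case False
      hence "round_risk C e1 = 1" using envD[OF e1(1)] by (auto simp: round_risk_def)
      with False e1(2) show ?thesis by auto
    qed
    then obtain \<tau> where \<tau>: "mem \<tau> (elapse 1 e1)" "residual \<tau> j"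
      "(if good C \<and> leaving \<tau> C + j \<le> k then ennreal (real (k - j) * \<delta>) else 1) \<le> round_risk C e1" by auto
    have "env j 0 x (elapse 1 e1)" using e1(1) by simp
    from round_code[OF this \<tau>(1,2) jk] show ?case
    proof (rule prob_conseq[OF _ _ \<tau>(3)])
      fix e2 assume e2: "(env (Suc j) 0 x e2 \<and> (\<exists>\<tau>'. mem \<tau>' e2 \<and> residual \<tau>' (Suc j)) \<or>
        env (Suc j) 1 x e2 \<and> found e2) \<and> run_time e2 \<le> run_time (elapse 1 e1) + 54 * N + 45"
      \<comment> \<open>With the test a round costs at most \<open>54 * N + 46\<close>, which is
        below \<open>100 * N\<close>.\<close>
      have "run_time e2 \<le> run_time e1 + 100 * N" using e2 N_ge_2 by simp
      moreover have "n * (100 * N) = (n - 1) * (100 * N) + 100 * N" using j(2) jk by (cases n) auto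
      ultimately have "run_time e2 + (n - 1) * (100 * N) \<le> run_time e + (k + 1) * (100 * N) + 2"
        using j(3) by linarith
      with e2 j(2) jk show "\<exists>m<n. ?I m e2"
        by (intro exI[of _ "n - 1"] conjI exI[of _ "Suc j"]) auto
    qed
  next
    case (2 n e1)
    then obtain j where j: "env j 0 x e1 \<and> (\<exists>\<tau>. mem \<tau> e1 \<and> residual \<tau> j) \<or> env j 1 x e1 \<and> found e1"
      "n + j = k + 1" "run_time e1 + n * (100 * N) \<le> run_time e + (k + 1) * (100 * N) + 2" by blast
    have found: "found (elapse d e1) \<longleftrightarrow> found e1" for d by (simp add: found_def)
    have "ready (elapse 1 e1)" if "mem \<tau> e1" for \<tau> using that by (simp add: mem_def ready_def stores_def)
    moreover have "failure (elapse 1 e1) \<le> round_risk C e1"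
    proof (cases "env j 1 x e1")
      case True
      thus ?thesis using envD(5)[of j 1 x e1] by (simp add: failure_def)
    next
      case False
      with j(1) have "env j 0 x e1" by blast
      note env1 = envD[OF this]
      have "\<not> vars e1 vJ \<le> k" using 2(3) env1 by simp
      thus ?thesis using env1 by (simp add: failure_def round_risk_def)
    qed
    ultimately show ?case using j(1,3) by (auto simp: found)
  qed
  show ?thesis unfolding attempt_code_def
  proof (intro prob_Seq_det det_Assign)
    let ?e1 = "elapse 1 (set_var vB (aval (Var vNxt) e) e)"
    let ?e2 = "elapse 1 (set_var vJ (aval (Const 0) ?e1) ?e1)"
    have e2: "env 0 0 x ?e2" "mem head ?e2"
      using env assms(2) stores_init by (simp_all add: env_def mem_def ready_def)
    hence "?I (k + 1) ?e2" using residual_head by (intro exI[of _ 0]) auto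
    moreover have "round_risk C ?e2 \<le> (if good C then ennreal (1 / 2) else 1)"
    proof (cases "good C")
      case True
      hence "leaving head C + 0 \<le> k" by (simp add: good_def)
      hence "round_risk C ?e2 = ennreal (real (k - 0) * \<delta>)"
        using e2(2) envD[OF e2(1)] True residual_head unfolding round_risk_def by auto
      also have "\<dots> \<le> ennreal (1 / 2)" by (rule ennreal_leI[OF \<delta>(2)])
      finally show ?thesis using True by simp
    next
      case False thus ?thesis using round_risk_le_1 by simp
    qed
    ultimately show "prob ans (While ?b round_code) ?e2 ?Q failure (if good C then ennreal (1 / 2) else 1)"
      using loop by (blast intro: prob_conseq)
  qed
qed

lemma init_code:
  "det ans init_code (initial_state k \<Delta> p s)
     (\<lambda>e'. env (k + 1) 0 (1 - p) e' \<and> ready e' \<and> run_time e' \<le> 3 * (k + 1) + 3)"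
proof -
  let ?I = "\<lambda>n e'. n + vars e' vJ = k + 1 \<and> vars e' vK = k \<and> vars e' vD = \<Delta> \<and> vars e' vS = s \<and>
     vars e' vN = 2 * vars e' vJ * (\<Delta> + k) \<and> vars e' vF = 0 \<and> rvars e' 0 = 1 - p \<and>
     arrays e' = (\<lambda>_ _. 0) \<and> run_time e' + 3 * n \<le> 3 * (k + 1) + 1"
  let ?b = "Le (Var vJ) (Var vK)"
  let ?c = "Assign vN (Plus (Var vN) (Plus (Plus (Var vD) (Var vK)) (Plus (Var vD) (Var vK)))) ;;
        Assign vJ (Plus (Var vJ) (Const 1))"
  have loop: "det ans (While ?b ?c) e' (\<lambda>e'. vars e' vJ = k + 1 \<and> vars e' vK = k \<and>
     vars e' vS = s \<and> vars e' vN = N \<and> vars e' vF = 0 \<and> rvars e' 0 = 1 - p \<and>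
     arrays e' = (\<lambda>_ _. 0) \<and> run_time e' \<le> 3 * (k + 1) + 2)"
    if "?I n e'" for n e'
    using that
  proof (rule det_While[where I = ?I], goal_cases)
    case (1 n e1)
    thus ?case by (intro det_intros exI[of _ "n - 1"]) (auto simp: algebra_simps)
  next
    case (2 n e1)
    hence "n = 0" by auto
    with 2 show ?case by (auto simp: N_eq)
  qed
  have init: "?I (k + 1) (elapse 1 (set_rvar 0 (rval (RMinus ROne (RVar 0)) (initial_state k \<Delta> p s)) (initial_state k \<Delta> p s)))"
    by (simp add: initial_state_def)
  show ?thesis
    unfolding init_code_def
    apply (rule det_Seq det_RAssign)+
    apply (rule det_conseq[OF loop[OF init]])
    apply (rule det_Assign)
    apply (auto simp: env_def ready_def fresh_def)
    done
qed

text \<open>Real variable 0 holds \<open>x\<close>. A trial doubles \<open>x\<close> and fails with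
  probability at most one half, so \<open>min 1 x\<close> does not increase in expectation; once
  \<open>x \<ge> 1\<close> it is trivial.\<close>

definition main_risk :: "nat set \<Rightarrow> state \<Rightarrow> ennreal" where
  "main_risk C e = (if vars e vF = 1 then 0 else if good C then min 1 (ennreal (rvars e 0)) else 1)"

definition output_ok :: "state \<Rightarrow> bool" where
  "output_ok e \<longleftrightarrow> returned_set e \<subseteq> V \<and> (s \<in> returned_set e \<longrightarrow>
     leaving head (returned_set e) \<le> k \<and> card (slots (returned_set e)) < N \<and>
     (\<forall>X. s \<in> X \<longrightarrow> X \<subset> returned_set e \<longrightarrow> leaving head (returned_set e) < leaving head X))"

text \<open>The hypothesis on \<open>n\<close> says that \<open>n\<close> doublings of
  \<open>1 - p\<close> reach 1, so at most \<open>n\<close> trials are made. The initial potential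
  is the failure probability claimed.\<close>

lemma local_search:
  assumes n: "1 \<le> 2 ^ n * (1 - p)"
  shows "prob ans local_search (initial_state k \<Delta> p s)
    (\<lambda>e'. output_ok e' \<and> run_time e' \<le> 3 * (k + 1) + 7 + n * (110 * ((k + 1) * N)))
    (\<lambda>e'. if s \<in> returned_set e' then 0 else 1)
    (if good C then min 1 (ennreal (1 - p)) else 1)"
proof -
  \<comment> \<open>A trial costs \<open>100 * ((k + 1) * N) + 3\<close>, plus 2 for test and
    doubling. As \<open>(k + 1) * N \<ge> 2\<close>, the factor 110 absorbs the constants.\<close>
  define c where "c = 110 * ((k + 1) * N)"
  define T where "T = 3 * (k + 1) + 3 + n * c"
  let ?S = "\<lambda>x e'. \<exists>j. env j 0 x e' \<and> ready e' \<or> env j 1 x e' \<and> found e'"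
  let ?I = "\<lambda>m e'. \<exists>x. ?S x e' \<and> 1 \<le> 2 ^ m * x \<and> run_time e' + m * c \<le> T"
  let ?b = "Conj (Neg (RLe ROne (RVar 0))) (Le (Var vF) (Const 0))"
  let ?R = "\<lambda>e'. (\<exists>x. ?S x e') \<and> run_time e' \<le> T + 1"
  have S_elapse: "?S x (elapse d e') \<longleftrightarrow> ?S x e'" for x d e'
    by (simp add: ready_def found_def)
  have loop: "prob ans (While ?b (RAssign 0 (RPlus (RVar 0) (RVar 0)) ;; attempt_code)) e' ?R failure (main_risk C e')"
    if "?I m e'" for m e'
    using that
  proof (rule prob_While[where I = ?I], goal_cases)
    case (1 m e1)
    then obtain x where x: "?S x e1" "1 \<le> 2 ^ m * x" "run_time e1 + m * c \<le> T" by blast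
    have b: "rvars e1 0 < 1" "vars e1 vF = 0" using 1(2) by simp_all
    then obtain j where e1: "env j 0 x e1" "ready e1" using x(1) by (auto dest: envD(5))
    have x1: "x < 1" using b envD(6)[OF e1(1)] by simp
    then obtain m' where m: "m = Suc m'" using x(2) by (cases m) auto
    have x0: "0 < x" using x(2) by (metis less_le_trans zero_less_mult_pos zero_less_one zero_less_numeral zero_less_power)
    let ?e2 = "elapse 1 (set_rvar 0 (rval (RPlus (RVar 0) (RVar 0)) (elapse 1 e1)) (elapse 1 e1))"
    have e2: "env j 0 (2 * x) ?e2" "ready ?e2" "run_time ?e2 = run_time e1 + 2"
      using e1 by (simp_all add: env_def ready_def)
    \<comment> \<open>\<open>a\<close> is the value of \<open>main_risk\<close> after a failed
      trial, with \<open>x\<close> already doubled.\<close>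
    define a where "a = (if good C then min 1 (ennreal (2 * x)) else 1)"
    show ?case
    proof (rule prob_Seq_det, rule det_RAssign,
        rule prob_conseq[OF prob_mono_scale[OF attempt_code[OF e2(1,2), where C = C]]])
      fix e3 assume e3: "?S (2 * x) e3 \<and> run_time e3 \<le> run_time ?e2 + (k + 1) * (100 * N) + 3"
      have "2 \<le> (k + 1) * N" using N_ge_2 by simp
      hence "run_time e3 \<le> run_time e1 + c" using e3 unfolding c_def e2(3) by simp
      hence "run_time e3 + m' * c \<le> T" using x(3) by (simp add: m)
      moreover have "1 \<le> 2 ^ m' * (2 * x)" using x(2) by (simp add: m)
      ultimately show "\<exists>l<m. ?I l e3" using e3 m by blast
    next
      fix e3 assume e3: "?S (2 * x) e3 \<and> run_time e3 \<le> run_time ?e2 + (k + 1) * (100 * N) + 3"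
      hence "rvars e3 0 = 2 * x" by (auto dest: envD(6))
      thus "main_risk C e3 \<le> a * failure e3" by (simp add: main_risk_def failure_def a_def)
    next
      show "a * (if good C then ennreal (1 / 2) else 1) \<le> main_risk C e1"
      proof (cases "good C")
        case True
        have min: "min 1 (ennreal y) = ennreal (min 1 y)" for y
          by (simp add: min_def ennreal_ge_1)
        have "min 1 (ennreal (2 * x)) * ennreal (1 / 2) = ennreal (min 1 (2 * x) * (1 / 2))"
          unfolding min using x0 by (subst ennreal_mult) auto
        also have "\<dots> \<le> ennreal (min 1 x)" using x0 x1 by (intro ennreal_leI) (simp add: min_def)
        also have "\<dots> = min 1 (ennreal x)" by (rule min[symmetric])
        finally show ?thesis using True envD[OF e1(1)] by (simp add: main_risk_def a_def)
      next
        case False thus ?thesis using envD[OF e1(1)] by (simp add: main_risk_def a_def)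
      qed
    qed simp
  next
    case (2 m e1)
    then obtain x where x: "?S x e1" "1 \<le> 2 ^ m * x" "run_time e1 + m * c \<le> T" by blast
    have "vars e1 vF = 0 \<or> vars e1 vF = 1" using x(1) by (auto dest: envD(5))
    hence "failure (elapse 1 e1) \<le> main_risk C e1"
      using 2(2) by (auto simp: failure_def main_risk_def min_def)
    thus ?case using x(1,3) S_elapse by auto
  qed
  have final: "det ans (IfElse (Le (Const 1) (Var vF)) (Assign 0 (Var vCnt)) (Assign 0 (Const 0))) e'
     (\<lambda>e''. (output_ok e'' \<and> run_time e'' \<le> T + 3) \<and> (if s \<in> returned_set e'' then 0 else 1) \<le> failure e')"
    if R: "?R e'" for e'
  proof (rule det_IfElse; rule det_Assign)
    assume "bval (Le (Const 1) (Var vF)) e'"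
    with R have found: "found e'" and F: "vars e' vF = 1" by (auto dest: envD(5))
    let ?e = "elapse 1 (set_var 0 (aval (Var vCnt) (elapse 1 e')) (elapse 1 e'))"
    have "returned_set ?e = arrays e' aQ ` {..<vars e' vCnt}" by (auto simp: returned_set_def)
    with found F R show "(output_ok ?e \<and> run_time ?e \<le> T + 3) \<and> (if s \<in> returned_set ?e then 0 else 1) \<le> failure e'"
      by (simp add: output_ok_def found_def Let_def)
  next
    assume "\<not> bval (Le (Const 1) (Var vF)) e'"
    thus "(output_ok (elapse 1 (set_var 0 (aval (Const 0) (elapse 1 e')) (elapse 1 e'))) \<and>
        run_time (elapse 1 (set_var 0 (aval (Const 0) (elapse 1 e')) (elapse 1 e'))) \<le> T + 3) \<and>
      (if s \<in> returned_set (elapse 1 (set_var 0 (aval (Const 0) (elapse 1 e')) (elapse 1 e'))) then 0 else 1) \<le> failure e'"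
      using R by (simp add: output_ok_def returned_set_def failure_def)
  qed
  have "prob ans local_search (initial_state k \<Delta> p s) (\<lambda>e'. output_ok e' \<and> run_time e' \<le> T + 3)
    (\<lambda>e'. if s \<in> returned_set e' then 0 else 1) (if good C then min 1 (ennreal (1 - p)) else 1)"
    unfolding local_search_def
  proof (rule prob_Seq_det, rule det_conseq[OF init_code], elim conjE)
    fix e1 assume e1: "env (k + 1) 0 (1 - p) e1" "ready e1" "run_time e1 \<le> 3 * (k + 1) + 3"
    have "?I n e1" using e1 n by (intro exI[of _ "1 - p"]) (auto simp: T_def)
    from loop[OF this]
    have while: "prob ans (While ?b (RAssign 0 (RPlus (RVar 0) (RVar 0)) ;; attempt_code)) e1 ?R failure (main_risk C e1)" .
    have risk: "main_risk C e1 \<le> (if good C then min 1 (ennreal (1 - p)) else 1)"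
      using envD[OF e1(1)] by (simp add: main_risk_def)
    show "prob ans (While ?b (RAssign 0 (RPlus (RVar 0) (RVar 0)) ;; attempt_code) ;;
       IfElse (Le (Const 1) (Var vF)) (Assign 0 (Var vCnt)) (Assign 0 (Const 0))) e1
       (\<lambda>e'. output_ok e' \<and> run_time e' \<le> T + 3) (\<lambda>e'. if s \<in> returned_set e' then 0 else 1)
       (if good C then min 1 (ennreal (1 - p)) else 1)"
      by (rule prob_Seq[OF prob_conseq[OF while prob_det[OF final] risk]])
  qed
  thus ?thesis by (rule prob_conseq) (auto simp: T_def c_def)
qed

lemma run_local_search:
  assumes p: "1 \<le> 2 ^ n * (1 - p)"
  defines "T \<equiv> 3 * (k + 1) + 7 + n * (110 * ((k + 1) * N))"
    and "D \<equiv> \<lambda>qt. exec ans qt local_search (initial_state k \<Delta> p s)"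
  shows "lossless_spmf (D qt)"
    and "\<sigma> \<in> set_spmf (D qt) \<Longrightarrow> output_ok \<sigma> \<and> num_queries \<sigma> \<le> T"
    and "good C \<Longrightarrow> p \<le> measure (measure_spmf (D qt)) {\<sigma>. s \<in> returned_set \<sigma>}"
    and "query_time_le qt K \<Longrightarrow> (\<integral>\<^sup>+ \<sigma>. of_nat (run_time \<sigma>) \<partial>measure_spmf (D qt)) \<le> K * of_nat T"
proof -
  let ?e = "initial_state k \<Delta> p s"
  have e: "run_time ?e = 0" "num_queries ?e = 0" by (simp_all add: initial_state_def)
  obtain M where M: "sim ans local_search ?e M" "\<And>e'. e' \<in> set_pmf M \<Longrightarrow> output_ok e' \<and> run_time e' \<le> T"
    "(\<integral>\<^sup>+ e'. (if s \<in> returned_set e' then 0 else 1) \<partial>measure_pmf M) \<le> (if good C then min 1 (ennreal (1 - p)) else 1)"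
    using local_search[OF p] unfolding prob_def T_def by blast
  have ret: "returned_set \<sigma> = returned_set e'" if "erase \<sigma> = erase e'" for \<sigma> e'
    using that by (simp add: returned_set_def erase_eq_iff)
  have "s \<in> returned_set (erase \<sigma>) \<longleftrightarrow> s \<in> returned_set \<sigma>" for \<sigma>
    by (simp add: returned_set_def)
  note res = sim_result[OF M(1), where P = "\<lambda>\<sigma>. s \<in> returned_set \<sigma>" and qt = qt, OF this]
  show "lossless_spmf (D qt)" unfolding D_def by (rule res(1))
  show "output_ok \<sigma> \<and> num_queries \<sigma> \<le> T" if \<sigma>: "\<sigma> \<in> set_spmf (D qt)"
  proof -
    obtain e' where e': "e' \<in> set_pmf M" "erase \<sigma> = erase e'" using res(2) \<sigma> unfolding D_def by blast
    \<comment> \<open>Both counters start at 0, and every query is also a step.\<close>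
    have "num_queries e' \<le> run_time e'" using M(1) e'(1) e unfolding sim_def by fastforce
    moreover have "num_queries \<sigma> = num_queries e'" using e'(2) by (simp add: erase_eq_iff)
    ultimately show ?thesis using M(2)[OF e'(1)] ret[OF e'(2)] by (simp add: output_ok_def)
  qed
  show "p \<le> measure (measure_spmf (D qt)) {\<sigma>. s \<in> returned_set \<sigma>}" if "good C"
  proof -
    have p1: "0 < 1 - p" using p by (metis less_le_trans zero_less_mult_pos zero_less_numeral zero_less_one zero_less_power)
    have "ennreal (measure_pmf.prob M {e'. s \<notin> returned_set e'}) = emeasure (measure_pmf M) {e'. s \<notin> returned_set e'}"
      by (simp add: measure_pmf.emeasure_eq_measure)
    also have "\<dots> = (\<integral>\<^sup>+ e'. indicator {e'. s \<notin> returned_set e'} e' \<partial>measure_pmf M)" by simp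
    also have "\<dots> = (\<integral>\<^sup>+ e'. (if s \<in> returned_set e' then 0 else 1) \<partial>measure_pmf M)"
      by (intro nn_integral_cong) (simp add: indicator_def)
    also have "\<dots> \<le> ennreal (1 - p)" using M(3) that by simp
    finally have "measure_pmf.prob M {e'. s \<notin> returned_set e'} \<le> 1 - p"
      using p1 by (simp add: ennreal_le_iff)
    moreover have "measure_pmf.prob M {e'. s \<notin> returned_set e'} = 1 - measure_pmf.prob M {e'. s \<in> returned_set e'}"
      using measure_pmf.prob_compl[of "{e'. s \<in> returned_set e'}" M] by (simp add: Compl_eq_Diff_UNIV[symmetric] Collect_neg_eq)
    ultimately show ?thesis using res(3) unfolding D_def by simp
  qed
  show "(\<integral>\<^sup>+ \<sigma>. of_nat (run_time \<sigma>) \<partial>measure_spmf (D qt)) \<le> K * of_nat T" if "query_time_le qt K"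
    using res(4)[OF that, of T] M(2) unfolding D_def by (simp add: e)
qed

end

section \<open>Incidence lists as slots\<close>

context
  fixes G :: "nat pair_pre_digraph" and outs ins :: "nat \<Rightarrow> (nat \<times> nat) list" and s :: nat
  assumes G: "pair_fin_digraph G" and lists: "incidence_lists G outs ins" and s: "s \<in> pverts G"
begin

interpretation pair_fin_digraph G by (rule G)

lemma outs: "distinct (outs v)" "set (outs v) = {e \<in> parcs G. fst e = v}"
  using lists unfolding incidence_lists_def by blast+

lemma fst_outs: "i < length (outs v) \<Longrightarrow> fst (outs v ! i) = v"
  using nth_mem[of i "outs v"] by (simp add: outs)

interpretation slotted_graph "pverts G" "\<lambda>v. length (outs v)" "\<lambda>v i. snd (outs v ! i)" s
proof
  fix v i assume "i < length (outs v)"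
  hence "outs v ! i \<in> parcs G" using nth_mem[of i "outs v"] by (simp add: outs)
  thus "snd (outs v ! i) \<in> pverts G" by (rule arc_snd_in_verts)
qed (use s finite_verts in auto)

text \<open>The tail of an edge determines its list, and its place there is unique because the list
  is distinct.\<close>

lemma bij_betw_slots: "bij_betw (\<lambda>(v, i). outs v ! i) (slots X) {e \<in> parcs G. fst e \<in> X}"
proof (rule bij_betw_imageI)
  show "inj_on (\<lambda>(v, i). outs v ! i) (slots X)"
  proof (rule inj_onI, clarify)
    fix v i w j assume *: "(v, i) \<in> slots X" "(w, j) \<in> slots X" "outs v ! i = outs w ! j"
    hence "i < length (outs v)" "j < length (outs w)" by (auto simp: slots_def)
    moreover from this * have "v = w" using fst_outs by metis
    ultimately show "v = w \<and> i = j" using * outs(1) by (simp add: nth_eq_iff_index_eq)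
  qed
  show "(\<lambda>(v, i). outs v ! i) ` slots X = {e \<in> parcs G. fst e \<in> X}"
  proof (intro equalityI subsetI)
    fix e assume "e \<in> (\<lambda>(v, i). outs v ! i) ` slots X"
    then obtain v i where "v \<in> X" "i < length (outs v)" "e = outs v ! i" by (auto simp: slots_def)
    moreover from this have "e \<in> set (outs v)" by simp
    ultimately show "e \<in> {e \<in> parcs G. fst e \<in> X}" by (simp add: outs)
  next
    fix e assume e: "e \<in> {e \<in> parcs G. fst e \<in> X}"
    hence "e \<in> set (outs (fst e))" by (simp add: outs)
    then obtain i where "i < length (outs (fst e))" "e = outs (fst e) ! i" by (auto simp: in_set_conv_nth)
    with e show "e \<in> (\<lambda>(v, i). outs v ! i) ` slots X"
      by (intro image_eqI[of _ _ "(fst e, i)"]) (auto simp: slots_def)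
  qed
qed

lemma leaving_eq_card_edges_leaving: "leaving (\<lambda>v i. snd (outs v ! i)) X = card (edges_leaving G X)"
proof -
  let ?A = "{(v, i) \<in> slots X. snd (outs v ! i) \<notin> X}"
  have "(\<lambda>(v, i). outs v ! i) ` ?A = {e \<in> parcs G. fst e \<in> X} \<inter> {e. snd e \<notin> X}"
    using bij_betw_imp_surj_on[OF bij_betw_slots[of X], symmetric] by auto
  also have "\<dots> = edges_leaving G X"
    using in_arcsD2 by (auto simp: edges_leaving_def edges_between_def)
  finally have "bij_betw (\<lambda>(v, i). outs v ! i) ?A (edges_leaving G X)"
    by (intro bij_betw_subset[OF bij_betw_slots]) auto
  thus ?thesis unfolding leaving_def by (rule bij_betw_same_card)
qed

text \<open>This links slots to edge sizes: it makes the sought component \<open>good\<close> and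
  turns the bound on scanned slots into one on the returned set.\<close>

lemma card_slots: 
  assumes "X \<subseteq> pverts G"
  shows "card (slots X) = edge_size G X + card (edges_leaving G X)"
proof -
  have "card (slots X) = card {e \<in> parcs G. fst e \<in> X}"
    by (rule bij_betw_same_card[OF bij_betw_slots])
  also have "{e \<in> parcs G. fst e \<in> X} = edges_between G X X \<union> edges_leaving G X"
    using in_arcsD2 by (auto simp: edges_leaving_def edges_between_def)
  also have "card \<dots> = card (edges_between G X X) + card (edges_leaving G X)"
    using finite_arcs by (intro card_Un_disjoint) (auto simp: edges_leaving_def edges_between_def)
  finally show ?thesis by (simp add: edge_size_def)
qed

lemma local_search_problem:
  assumes "1 \<le> \<Delta>"
  shows "local_search_problem (pverts G) (\<lambda>v. length (outs v)) (\<lambda>v i. snd (outs v ! i)) s k \<Delta>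
    (2 * (k + 1) * (\<Delta> + k)) (answer outs ins)"
  by unfold_locales (use assms in \<open>auto simp: nth_entry_def\<close>)

lemma local_search_correct:
  fixes k \<Delta> n :: nat and p :: real and qt :: "query \<Rightarrow> nat pmf"
  assumes \<Delta>: "1 \<le> \<Delta>" and p: "1 \<le> 2 ^ n * (1 - p)"
  defines "T \<equiv> 3 * (k + 1) + 7 + n * (110 * ((k + 1) * (2 * (k + 1) * (\<Delta> + k))))"
    and "D \<equiv> run local_search outs ins qt k \<Delta> p s"
  shows "lossless_spmf D"
    and "\<sigma> \<in> set_spmf D \<Longrightarrow> num_queries \<sigma> \<le> T \<and> returned_set \<sigma> \<subseteq> pverts G \<and>
      (s \<in> returned_set \<sigma> \<longrightarrow> minimal_edge_out_component G k s (returned_set \<sigma>) \<and>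
         edge_size G (returned_set \<sigma>) < 2 * (k + 1) * (\<Delta> + k))"
    and "\<lbrakk>edge_out_component G k C; s \<in> C; edge_size G C \<le> \<Delta>\<rbrakk> \<Longrightarrow>
      p \<le> measure (measure_spmf D) {\<sigma>. s \<in> returned_set \<sigma>}"
    and "query_time_le qt K \<Longrightarrow> (\<integral>\<^sup>+ \<sigma>. of_nat (run_time \<sigma>) \<partial>measure_spmf D) \<le> K * of_nat T"
proof -
  interpret L: local_search_problem "pverts G" "\<lambda>v. length (outs v)" "\<lambda>v i. snd (outs v ! i)" s k \<Delta>
    "2 * (k + 1) * (\<Delta> + k)" "answer outs ins"
    by (rule local_search_problem[OF \<Delta>])
  note res = L.run_local_search[OF p, folded T_def, where qt = qt, folded run_def, folded D_def]
  show "lossless_spmf D" by (rule res(1))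
  show "num_queries \<sigma> \<le> T \<and> returned_set \<sigma> \<subseteq> pverts G \<and>
      (s \<in> returned_set \<sigma> \<longrightarrow> minimal_edge_out_component G k s (returned_set \<sigma>) \<and>
         edge_size G (returned_set \<sigma>) < 2 * (k + 1) * (\<Delta> + k))" if "\<sigma> \<in> set_spmf D"
    using res(2)[OF that] card_slots[of "returned_set \<sigma>"]
    unfolding L.output_ok_def leaving_eq_card_edges_leaving minimal_edge_out_component_def edge_out_component_def
    by auto
  show "p \<le> measure (measure_spmf D) {\<sigma>. s \<in> returned_set \<sigma>}"
    if "edge_out_component G k C" "s \<in> C" "edge_size G C \<le> \<Delta>"
    using that card_slots[of C]
    by (intro res(3)[of C]) (simp add: L.good_def leaving_eq_card_edges_leaving edge_out_component_def)
  show "query_time_le qt K \<Longrightarrow> (\<integral>\<^sup>+ \<sigma>. of_nat (run_time \<sigma>) \<partial>measure_spmf D) \<le> K * of_nat T"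
    by (rule res(4))
qed

end

section \<open>The number of trials and the constants of the bounds\<close>

lemma repetitions:
  assumes "p < 1"
  obtains n :: nat where "1 \<le> 2 ^ n * (1 - p)" "real n \<le> 3 * max 1 (ln (1 / (1 - p)))"
proof
  \<comment> \<open>For \<open>p \<le> 0\<close> the logarithm is at most 0, and \<open>nat\<close>
    makes \<open>n = 0\<close>. In the bound with factor 3, changing the base to \<open>ln\<close>
    accounts for 2 and rounding up for 1.\<close>
  define n where "n = nat \<lceil>log 2 (1 / (1 - p))\<rceil>"
  have "1 / (1 - p) = 2 powr log 2 (1 / (1 - p))" using assms by simp
  also have "\<dots> \<le> 2 powr real n" unfolding n_def by (intro powr_mono) linarith+
  also have "\<dots> = 2 ^ n" by (simp add: powr_realpow)
  finally show "1 \<le> 2 ^ n * (1 - p)" using assms by (simp add: field_simps)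
  have "real n \<le> max 0 (log 2 (1 / (1 - p)) + 1)" unfolding n_def by linarith
  moreover have "log 2 (1 / (1 - p)) \<le> 2 * max 1 (ln (1 / (1 - p)))"
  proof -
    have "1 / 2 \<le> ln (2 :: real)" using ln2_ge_two_thirds by simp
    hence "max 1 (ln (1 / (1 - p))) * 1 \<le> max 1 (ln (1 / (1 - p))) * (2 * ln 2)"
      by (intro mult_left_mono) auto
    hence "ln (1 / (1 - p)) \<le> 2 * max 1 (ln (1 / (1 - p))) * ln 2" by simp
    thus ?thesis unfolding log_def by (subst divide_le_eq) auto
  qed
  ultimately show "real n \<le> 3 * max 1 (ln (1 / (1 - p)))" by linarith
qed

text \<open>The constant is \<open>1333 = 1320 + 13\<close>, where \<open>1320 = 3 * 220 * 2\<close>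
  comes from the trials and 13 from the additive term.\<close>

lemma step_bound:
  assumes \<Delta>: "1 \<le> \<Delta>" and n: "real n \<le> 3 * max 1 (ln (1 / (1 - p)))"
  shows "real (3 * (k + 1) + 7 + n * (110 * ((k + 1) * (2 * (k + 1) * (\<Delta> + k))))) \<le>
    1333 * query_bound k \<Delta> p"
proof -
  define L where "L = max 1 (ln (1 / (1 - p)))"
  define a d where "a = real k ^ 2 + 1" and "d = real \<Delta> + real k"
  have L: "1 \<le> L" "real n \<le> 3 * L" using n by (auto simp: L_def)
  have a: "1 \<le> a" and d: "1 \<le> d" "real k \<le> d" using \<Delta> by (auto simp: a_def d_def)
  \<comment> \<open>This is \<open>(k - 1) ^ 2 \<ge> 0\<close> rearranged.\<close>
  have sq: "(real k + 1) ^ 2 \<le> 2 * a"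
    using zero_le_power2[of "real k - 1"] by (simp add: a_def power2_eq_square algebra_simps)
  define m y where "m = a * d * L" and "y = real n * (220 * ((real k + 1) ^ 2 * d))"
  have "1 * d \<le> a * d" using a d by (intro mult_right_mono) auto
  moreover have "a * d * 1 \<le> a * d * L" using a d L by (intro mult_left_mono) auto
  ultimately have "d \<le> m" by (simp add: m_def)
  moreover have "y \<le> (3 * L) * (220 * (2 * a * d))"
    unfolding y_def using L sq a d by (intro mult_mono) auto
  hence "y \<le> 1320 * m" by (simp add: m_def mult_ac)
  moreover have "3 * (real k + 1) + 7 \<le> 13 * d" using d by simp
  ultimately have "3 * (real k + 1) + 7 + y \<le> 1333 * m" by simp
  moreover have "real (3 * (k + 1) + 7 + n * (110 * ((k + 1) * (2 * (k + 1) * (\<Delta> + k))))) =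
      3 * (real k + 1) + 7 + y"
    by (simp add: y_def d_def power2_eq_square) (simp add: algebra_simps)
  ultimately show ?thesis
    unfolding query_bound_def m_def a_def d_def L_def by simp
qed

theorem theorem4:
  shows "\<exists>alg :: com.
    (\<exists>c\<^sub>q c\<^sub>s :: real.
      \<forall>(G :: nat pair_pre_digraph) outs ins qt (k :: nat) (\<Delta> :: nat) (p :: real) (s :: nat).
        pair_fin_digraph G \<and> incidence_lists G outs ins \<and> \<Delta> \<ge> 1 \<and> p < 1 \<and> s \<in> pverts G \<longrightarrow>
        lossless_spmf (run alg outs ins qt k \<Delta> p s) \<and>
        (\<forall>\<sigma> \<in> set_spmf (run alg outs ins qt k \<Delta> p s).
           real (num_queries \<sigma>) \<le> c\<^sub>q * query_bound k \<Delta> p \<and>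
           returned_set \<sigma> \<subseteq> pverts G \<and>
           ({s} \<subseteq> returned_set \<sigma> \<longrightarrow>
              minimal_edge_out_component G k s (returned_set \<sigma>) \<and>
              real (edge_size G (returned_set \<sigma>)) \<le> c\<^sub>s * ((real k + 1) * (real \<Delta> + real k)))) \<and>
        ((\<exists>C. edge_out_component G k C \<and> s \<in> C \<and> edge_size G C \<le> \<Delta>) \<longrightarrow>
           measure (measure_spmf (run alg outs ins qt k \<Delta> p s)) {\<sigma>. {s} \<subseteq> returned_set \<sigma>} \<ge> p)) \<and>
    (\<forall>c :: real. \<exists>c\<^sub>t :: real.
      \<forall>(G :: nat pair_pre_digraph) outs ins qt (k :: nat) (\<Delta> :: nat) (p :: real) (s :: nat).
        pair_fin_digraph G \<and> incidence_lists G outs ins \<and> \<Delta> \<ge> 1 \<and> p < 1 \<and> s \<in> pverts G \<and>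
        (\<forall>q. (\<integral>\<^sup>+ t. of_nat t \<partial>measure_pmf (qt q)) \<le> ennreal c) \<longrightarrow>
        (\<integral>\<^sup>+ \<sigma>. of_nat (run_time \<sigma>) \<partial>measure_spmf (run alg outs ins qt k \<Delta> p s))
          \<le> ennreal (c\<^sub>t * query_bound k \<Delta> p))"
proof (rule exI[of _ local_search], intro conjI)
  show "\<exists>c\<^sub>q c\<^sub>s :: real.
      \<forall>(G :: nat pair_pre_digraph) outs ins qt (k :: nat) (\<Delta> :: nat) (p :: real) (s :: nat).
        pair_fin_digraph G \<and> incidence_lists G outs ins \<and> \<Delta> \<ge> 1 \<and> p < 1 \<and> s \<in> pverts G \<longrightarrow>
        lossless_spmf (run local_search outs ins qt k \<Delta> p s) \<and>
        (\<forall>\<sigma> \<in> set_spmf (run local_search outs ins qt k \<Delta> p s).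
           real (num_queries \<sigma>) \<le> c\<^sub>q * query_bound k \<Delta> p \<and>
           returned_set \<sigma> \<subseteq> pverts G \<and>
           ({s} \<subseteq> returned_set \<sigma> \<longrightarrow>
              minimal_edge_out_component G k s (returned_set \<sigma>) \<and>
              real (edge_size G (returned_set \<sigma>)) \<le> c\<^sub>s * ((real k + 1) * (real \<Delta> + real k)))) \<and>
        ((\<exists>C. edge_out_component G k C \<and> s \<in> C \<and> edge_size G C \<le> \<Delta>) \<longrightarrow>
           measure (measure_spmf (run local_search outs ins qt k \<Delta> p s)) {\<sigma>. {s} \<subseteq> returned_set \<sigma>} \<ge> p)"
  \<comment> \<open>1333 is the constant of \<open>step_bound\<close>, and 2 is the leading factor
    of \<open>N\<close>.\<close>
  proof (rule exI[of _ 1333], rule exI[of _ 2], intro allI impI, elim conjE)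
    fix G :: "nat pair_pre_digraph" and outs ins qt and k \<Delta> :: nat and p :: real and s :: nat
    assume G: "pair_fin_digraph G" "incidence_lists G outs ins" "s \<in> pverts G" "1 \<le> \<Delta>" and p: "p < 1"
    obtain n :: nat where n: "1 \<le> 2 ^ n * (1 - p)" "real n \<le> 3 * max 1 (ln (1 / (1 - p)))"
      using repetitions[OF p] .
    note correct = local_search_correct[OF G n(1), where qt = qt and k = k]
    let ?D = "run local_search outs ins qt k \<Delta> p s"
    have "real (num_queries \<sigma>) \<le> 1333 * query_bound k \<Delta> p \<and> returned_set \<sigma> \<subseteq> pverts G \<and>
        ({s} \<subseteq> returned_set \<sigma> \<longrightarrow> minimal_edge_out_component G k s (returned_set \<sigma>) \<and>
         real (edge_size G (returned_set \<sigma>)) \<le> 2 * ((real k + 1) * (real \<Delta> + real k)))"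
      if "\<sigma> \<in> set_spmf ?D" for \<sigma>
    proof -
      note \<sigma> = correct(2)[OF that]
      have "real (num_queries \<sigma>) \<le> 1333 * query_bound k \<Delta> p"
        using \<sigma> by (intro order.trans[OF _ step_bound[OF G(4) n(2)]]) (simp only: of_nat_le_iff)
      moreover have "real (edge_size G (returned_set \<sigma>)) \<le> 2 * ((real k + 1) * (real \<Delta> + real k))"
        if "s \<in> returned_set \<sigma>"
      proof -
        have "edge_size G (returned_set \<sigma>) \<le> 2 * (k + 1) * (\<Delta> + k)" using \<sigma> that by simp
        hence "real (edge_size G (returned_set \<sigma>)) \<le> real (2 * (k + 1) * (\<Delta> + k))"
          by (simp only: of_nat_le_iff)
        thus ?thesis by (simp add: algebra_simps)
      qed
      ultimately show ?thesis using \<sigma> by simp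
    qed
    with correct(1,3) show "lossless_spmf ?D \<and> (\<forall>\<sigma> \<in> set_spmf ?D.
           real (num_queries \<sigma>) \<le> 1333 * query_bound k \<Delta> p \<and> returned_set \<sigma> \<subseteq> pverts G \<and>
           ({s} \<subseteq> returned_set \<sigma> \<longrightarrow> minimal_edge_out_component G k s (returned_set \<sigma>) \<and>
              real (edge_size G (returned_set \<sigma>)) \<le> 2 * ((real k + 1) * (real \<Delta> + real k)))) \<and>
        ((\<exists>C. edge_out_component G k C \<and> s \<in> C \<and> edge_size G C \<le> \<Delta>) \<longrightarrow>
           p \<le> measure (measure_spmf ?D) {\<sigma>. {s} \<subseteq> returned_set \<sigma>})"
      by auto
  qed
  show "\<forall>c :: real. \<exists>c\<^sub>t :: real.
      \<forall>(G :: nat pair_pre_digraph) outs ins qt (k :: nat) (\<Delta> :: nat) (p :: real) (s :: nat).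
        pair_fin_digraph G \<and> incidence_lists G outs ins \<and> \<Delta> \<ge> 1 \<and> p < 1 \<and> s \<in> pverts G \<and>
        (\<forall>q. (\<integral>\<^sup>+ t. of_nat t \<partial>measure_pmf (qt q)) \<le> ennreal c) \<longrightarrow>
        (\<integral>\<^sup>+ \<sigma>. of_nat (run_time \<sigma>) \<partial>measure_spmf (run local_search outs ins qt k \<Delta> p s))
          \<le> ennreal (c\<^sub>t * query_bound k \<Delta> p)"
  \<comment> \<open>A query costs one unit plus at most \<open>c\<close> in expectation. The maximum
    is taken since \<open>ennreal c\<close> is 0 for negative \<open>c\<close>.\<close>
  proof (intro allI, rule_tac x = "(1 + max 0 c) * 1333" in exI, intro allI impI, elim conjE)
    fix c :: real and G :: "nat pair_pre_digraph" and outs ins and k \<Delta> :: nat and p :: real and s :: nat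
    fix qt :: "query \<Rightarrow> nat pmf"
    assume G: "pair_fin_digraph G" "incidence_lists G outs ins" "s \<in> pverts G" "1 \<le> \<Delta>" and p: "p < 1"
      and qt: "\<forall>q. (\<integral>\<^sup>+ t. of_nat t \<partial>measure_pmf (qt q)) \<le> ennreal c"
    obtain n :: nat where n: "1 \<le> 2 ^ n * (1 - p)" "real n \<le> 3 * max 1 (ln (1 / (1 - p)))"
      using repetitions[OF p] .
    define T where "T = 3 * (k + 1) + 7 + n * (110 * ((k + 1) * (2 * (k + 1) * (\<Delta> + k))))"
    have T: "real T \<le> 1333 * query_bound k \<Delta> p"
      unfolding T_def by (rule step_bound[OF G(4) n(2)])
    have q: "query_time_le qt (1 + ennreal c)"
      using qt by (auto simp: query_time_le_def intro: add_left_mono)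
    have c: "1 + ennreal c = ennreal (1 + max 0 c)"
      by (subst ennreal_plus) (auto simp: max_def ennreal_neg)
    from local_search_correct(4)[OF G n(1) q, where k = k, folded T_def, unfolded c]
    have "(\<integral>\<^sup>+ \<sigma>. of_nat (run_time \<sigma>) \<partial>measure_spmf (run local_search outs ins qt k \<Delta> p s)) \<le>
        ennreal (1 + max 0 c) * of_nat T" .
    also have "\<dots> = ennreal ((1 + max 0 c) * real T)"
      by (simp add: ennreal_of_nat_eq_real_of_nat ennreal_mult)
    also have "\<dots> \<le> ennreal ((1 + max 0 c) * (1333 * query_bound k \<Delta> p))"
      using T by (intro ennreal_leI mult_left_mono) auto
    finally show "(\<integral>\<^sup>+ \<sigma>. of_nat (run_time \<sigma>) \<partial>measure_spmf (run local_search outs ins qt k \<Delta> p s)) \<le>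
        ennreal ((1 + max 0 c) * 1333 * query_bound k \<Delta> p)"
      by (simp only: mult.assoc)
  qed
qed

end
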